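(* For all positive integers $n$ and $k \geq 3$, there exists a point-line configuration $(P,\mathcal{L})$ in the plane such that $|P|=|\mathcal{L}|=n$, \[|I(P,\mathcal{L})|\geq n^{\frac{5}{4}-\frac{1}{2k}+o(1)},\] and $(P,\mathcal{L})$ does not contain a subconfiguration isomorphic to a subdivided $k$-clique. Here $o(1)$ denotes a quantity tending to $0$ as $n\to\infty$ with $k$ fixed.
   Context: For a finite set $P$ of points and a finite set $\mathcal{L}$ of lines in $\mathbb{R}^2$, $I(P,\mathcal{L})$ is the set of pairs $(p,L)\in P\times\mathcal{L}$ with $p\in L$. The incidence graph $G(P,\mathcal{L})$ is the (oriented) bipartite graph with vertex set $P\cup\mathcal{L}$ and edge set $I(P,\mathcal{L})$, edges oriented from points to lines. Two configurations are isomorphic if their incidence graphs are isomorphic (points corresponding to points and lines to lines). A subconfiguration of $(P,\mathcal{L})$ is a pair $(P_1,\mathcal{L}_1)$ with $P_1\subseteq P$ and $\mathcal{L}_1\subseteq\mathcal{L}$. Subdivided $k$-clique ($k\ge 3$): a configuration $(P_0,\mathcal{L}_0)$ where $P_0$ is a set of $k+\binom{k}{2}$ points, $k$ of them called black and the other $\binom{k}{2}$ called white, and $\mathcal{L}_0$ is a set of $2\binom{k}{2}$ lines in the plane, such that: for any two black points there are two lines from $\mathcal{L}_0$, each containing one of the two black points, that intersect in a white point; each white point lies on exactly two lines from $\mathcal{L}_0$; and each line from $\mathcal{L}_0$ contains exactly one black and exactly one white point. That is, the graph on $P_0$ in which two points are adjacent if and only if they lie on a common line of $\mathcal{L}_0$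 is the 1-subdivision of $K_k$ (each edge of $K_k$ replaced by a path of length two through a new white vertex). *)

theory Defs
  imports "HOL-Analysis.Analysis"
begin

type_synonym point = "real ^ 2"

definition is_line :: "point set \<Rightarrow> bool" where
  "is_line l \<longleftrightarrow> affine l \<and> aff_dim l = 1"

definition configuration :: "point set \<Rightarrow> point set set \<Rightarrow> bool" where
  "configuration P L \<longleftrightarrow> finite P \<and> finite L \<and> (\<forall>l\<in>L. is_line l)"

definition incidences :: "point set \<Rightarrow> point set set \<Rightarrow> (point \<times> point set) set" where
  "incidences P L = {(p, l). p \<in> P \<and> l \<in> L \<and> p \<in> l}"

text \<open>
  The incidence graph has vertex classes \<open>P\<close> and \<open>L\<close> and edge set \<open>incidences P L\<close>, each edge
  oriented from its point to its line. An isomorphism sending points to points and lines to lines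
  is given by its restrictions \<open>f\<close> and \<open>g\<close> to the two vertex classes.
\<close>
definition config_isomorphic ::
  "point set \<Rightarrow> point set set \<Rightarrow> point set \<Rightarrow> point set set \<Rightarrow> bool" where
  "config_isomorphic P L P' L' \<longleftrightarrow>
     (\<exists>f g. bij_betw f P P' \<and> bij_betw g L L' \<and>
        (\<forall>p\<in>P. \<forall>l\<in>L. (p, l) \<in> incidences P L \<longleftrightarrow> (f p, g l) \<in> incidences P' L'))"

text \<open>\<open>B\<close> is the set of black points and \<open>W\<close> the set of white points.\<close>
definition subdivided_clique :: "nat \<Rightarrow> point set \<Rightarrow> point set set \<Rightarrow> bool" where
  "subdivided_clique k P L \<longleftrightarrow>
     configuration P L \<and>
     (\<exists>B W. P = B \<union> W \<and> B \<inter> W = {} \<and>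
        card B = k \<and> card W = k choose 2 \<and> card L = 2 * (k choose 2) \<and>
        (\<forall>b\<in>B. \<forall>b'\<in>B. b \<noteq> b' \<longrightarrow>
           (\<exists>l\<in>L. \<exists>l'\<in>L. \<exists>w\<in>W. l \<noteq> l' \<and> b \<in> l \<and> b' \<in> l' \<and> l \<inter> l' = {w})) \<and>
        (\<forall>w\<in>W. card {l \<in> L. w \<in> l} = 2) \<and>
        (\<forall>l\<in>L. card (B \<inter> l) = 1 \<and> card (W \<inter> l) = 1))"

definition contains_subdivided_clique :: "nat \<Rightarrow> point set \<Rightarrow> point set set \<Rightarrow> bool" where
  "contains_subdivided_clique k P L \<longleftrightarrow>
     (\<exists>P1 L1 P0 L0. P1 \<subseteq> P \<and> L1 \<subseteq> L \<and> subdivided_clique k P0 L0 \<and>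
        config_isomorphic P1 L1 P0 L0)"

end

theory Submission
  imports Defs "HOL-Computational_Algebra.Primes"
begin

text \<open>
  The configuration is obtained by deletion from a random part of a point-line configuration that
  has as many incidences as the Szemeredi-Trotter theorem permits, up to a constant factor.

  Take the \<open>N = 2 A\<^sup>3\<close> points \<open>(x, y)\<close> with \<open>x < A\<close>, \<open>y < 2 A\<^sup>2\<close> and the \<open>N\<close> lines \<open>y = m x + c\<close>
  with \<open>m < A\<close>, \<open>c < 2 A\<^sup>2\<close>; they have at least \<open>A\<^sup>4\<close> incidences. What makes this grid useful is that
  it has few paths of the form point, line, point, line, point: between two fixed points
  \<open>(x\<^sub>1, y\<^sub>1)\<close> and \<open>(x\<^sub>2, y\<^sub>2)\<close> there are only \<open>A ^ (1 + o(1))\<close> of them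
  (\<open>card_grid_two_line_paths_le\<close>). Indeed, if the lines have slopes \<open>m\<^sub>1 \<noteq> m\<^sub>2\<close> and meet at abscissa
  \<open>x\<close>, then \<open>(m\<^sub>2 - m\<^sub>1) (x - x\<^sub>1) = y\<^sub>1 - y\<^sub>2 + m\<^sub>2 (x\<^sub>2 - x\<^sub>1)\<close>. Once \<open>m\<^sub>2\<close> is chosen, in one of \<open>A\<close>
  ways, \<open>x - x\<^sub>1\<close> divides a known nonzero integer of size at most \<open>A\<^sup>2\<close>, and the number of divisors
  of an integer \<open>j\<close> is \<open>j ^ o(1)\<close> (\<open>divisor_bound\<close>).

  A copy of the subdivided \<open>k\<close>-clique is determined by its \<open>k\<close> black points and one such path for
  each of the \<open>C = k choose 2\<close> pairs of them. So the grid contains at most \<open>N ^ k * A ^ (C + o(1))\<close> copies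
  (\<open>card_clique_copies_le\<close>), each with \<open>k + C\<close> points and \<open>2 C\<close> lines. Choose \<open>n\<close> of the points and
  \<open>n\<close> of the lines at random, put \<open>q = n / N\<close>, and delete one point of each surviving copy
  (\<open>deletion_method\<close>). On average at least \<open>A\<^sup>4 q\<^sup>2\<close> incidences survive the sampling. A copy survives with
  probability at most \<open>q ^ (k + 3 C)\<close>, and the deletion then costs about \<open>A q\<close> incidences. The cost is at most half
  of the gain as soon as \<open>A ^ (8 k) \<ge> n ^ (3 k + 2 + o(1))\<close>. With \<open>A\<close> of this order, the number of remaining
  incidences is of order \<open>A\<^sup>4 q\<^sup>2\<close>, that is, of order \<open>n\<^sup>2 / A\<^sup>2\<close>, whose exponent is
  \<open>2 - (3 k + 2) / (4 k) = 5 / 4 - 1 / (2 k)\<close>.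

  Points and lines without incidences belong to no copy, so they can be added afterwards to restore
  the cardinality \<open>n\<close> (\<open>pad_with_isolated\<close>).
\<close>

section \<open>The divisor bound\<close>

definition divisor_count :: "nat \<Rightarrow> nat" where
  "divisor_count n = card {d. d dvd n}"

lemma divisor_count_mult_le:
  assumes "a > 0" "b > 0"
  shows "divisor_count (a * b) \<le> divisor_count a * divisor_count b"
proof -
  have "{d. d dvd a * b} \<subseteq> (\<lambda>(x, y). x * y) ` ({d. d dvd a} \<times> {d. d dvd b})"
    using division_decomp[of _ a b] by (force simp: image_iff)
  moreover have "finite ({d. d dvd a} \<times> {d. d dvd b})"
    using assms by simp
  ultimately have "card {d. d dvd a * b} \<le> card ({d. d dvd a} \<times> {d. d dvd b})"
    by (meson card_image_le card_mono finite_imageI le_trans)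
  then show ?thesis
    by (simp add: divisor_count_def card_cartesian_product)
qed

lemma divisor_count_prime_power:
  fixes p :: nat
  assumes "prime p"
  shows "divisor_count (p ^ e) \<le> e + 1"
proof -
  have "{d. d dvd p ^ e} \<subseteq> (\<lambda>i. p ^ i) ` {..e}"
    using divides_primepow_nat[OF assms] by auto
  then have "card {d. d dvd p ^ e} \<le> card {..e}"
    by (meson card_image_le card_mono finite_imageI finite_atMost le_trans)
  then show ?thesis by (simp add: divisor_count_def)
qed

text \<open>
  Each prime factor \<open>p\<close>, counted with multiplicity, at most doubles the number of divisors, while it
  multiplies \<open>n powr \<epsilon>\<close> by \<open>p powr \<epsilon> \<ge> 2\<close>.
\<close>

lemma divisor_count_le_of_large_primes:
  fixes \<epsilon> :: real
  assumes "n > 0" "\<And>p. prime p \<Longrightarrow> p dvd n \<Longrightarrow> 2 \<le> real p powr \<epsilon>"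
  shows "real (divisor_count n) \<le> real n powr \<epsilon>"
  using assms
proof (induction n rule: less_induct)
  case (less n)
  show ?case
  proof (cases "n = 1")
    case True
    then show ?thesis by (simp add: divisor_count_def)
  next
    case False
    then obtain p where p: "prime p" "p dvd n" using prime_factor_nat by blast
    then obtain m where m: "n = p * m" by blast
    have mpos: "m > 0" using less.prems(1) m by simp
    have "m < n" using p(1) m mpos prime_gt_1_nat by simp
    then have IH: "real (divisor_count m) \<le> real m powr \<epsilon>"
      using less.IH less.prems(2) m mpos by (metis dvd_mult)
    have "divisor_count n \<le> divisor_count p * divisor_count m"
      unfolding m using p(1) mpos by (intro divisor_count_mult_le) (auto simp: prime_gt_0_nat)
    also have "\<dots> \<le> 2 * divisor_count m"
      using divisor_count_prime_power[OF p(1), of 1] by simp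
    finally have "real (divisor_count n) \<le> 2 * real (divisor_count m)"
      by linarith
    also have "\<dots> \<le> real p powr \<epsilon> * real m powr \<epsilon>"
      using less.prems(2)[OF p] IH by (intro mult_mono) auto
    also have "\<dots> = real n powr \<epsilon>"
      by (simp add: m powr_mult)
    finally show ?thesis .
  qed
qed

text \<open>
  A prime \<open>p\<close> that is too small for the doubling argument is split off with its full multiplicity
  \<open>e\<close>. It contributes \<open>e + 1\<close> to the number of divisors, which costs a factor \<open>K\<close> compared to
  \<open>(p ^ e) powr \<epsilon>\<close>, but this happens only once for each small prime.
\<close>

lemma divisor_count_le_except_primes:
  fixes \<epsilon> K :: real
  assumes "finite Q" "\<And>p. p \<in> Q \<Longrightarrow> prime p"
    and K: "\<And>p e. prime p \<Longrightarrow> real e + 1 \<le> K * real p powr (\<epsilon> * real e)"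
    and "n > 0" "\<And>p. prime p \<Longrightarrow> p dvd n \<Longrightarrow> p \<notin> Q \<Longrightarrow> 2 \<le> real p powr \<epsilon>"
  shows "real (divisor_count n) \<le> K ^ card Q * real n powr \<epsilon>"
  using assms(1,2,4,5)
proof (induction Q arbitrary: n rule: finite_induct)
  case empty
  then show ?case using divisor_count_le_of_large_primes[of n \<epsilon>] by simp
next
  case (insert q Q)
  have q: "prime q" using insert.prems by simp
  define e where "e = multiplicity q n"
  obtain m where m: "n = q ^ e * m" "\<not> q dvd m"
    using multiplicity_decompose'[of n q] q insert.prems(2) unfolding e_def
    by (metis not_prime_unit gr_implies_not0)
  have mpos: "m > 0" using insert.prems(2) m by (cases m) auto
  have K0: "K \<ge> 0"
    using K[OF q, of 0] q by (auto simp: prime_gt_0_nat)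
  have IH: "real (divisor_count m) \<le> K ^ card Q * real m powr \<epsilon>"
  proof (rule insert.IH)
    fix p assume p: "prime p" "p dvd m" "p \<notin> Q"
    then have "p \<noteq> q" "p dvd n" using m by auto
    with p show "2 \<le> real p powr \<epsilon>" using insert.prems(3) by auto
  qed (use insert.prems mpos in auto)
  have "divisor_count n \<le> divisor_count (q ^ e) * divisor_count m"
    unfolding m(1) using q mpos by (intro divisor_count_mult_le) (auto simp: prime_gt_0_nat)
  also have "\<dots> \<le> (e + 1) * divisor_count m"
    using divisor_count_prime_power[OF q] by (rule mult_right_mono) simp
  finally have "real (divisor_count n) \<le> (real e + 1) * real (divisor_count m)"
    by (metis of_nat_1 of_nat_add of_nat_le_iff of_nat_mult)
  also have "\<dots> \<le> (K * real q powr (\<epsilon> * real e)) * (K ^ card Q * real m powr \<epsilon>)"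
    using K[OF q] IH K0 by (intro mult_mono) auto
  also have "real q powr (\<epsilon> * real e) = real (q ^ e) powr \<epsilon>"
    using q by (simp add: powr_powr powr_realpow[symmetric] prime_gt_0_nat mult.commute)
  finally show ?case
    using insert.hyps by (simp add: m(1) powr_mult mult_ac)
qed

text \<open>
  Only the finitely many primes below \<open>2 powr (1 / \<epsilon>)\<close> are small, so their total cost is a constant
  that depends on \<open>\<epsilon>\<close> alone.
\<close>

theorem divisor_bound:
  fixes \<epsilon> :: real
  assumes "\<epsilon> > 0"
  obtains C where "C > 0" "\<And>n. n > 0 \<Longrightarrow> real (divisor_count n) \<le> C * real n powr \<epsilon>"
proof
  \<comment> \<open>With this value, \<open>e + 1 \<le> K (1 + \<epsilon> e ln 2) \<le> K 2 powr (\<epsilon> e)\<close>.\<close>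
  define K where "K = 1 + 1 / (\<epsilon> * ln 2)"
  define Q where "Q = {p :: nat. prime p \<and> real p < 2 powr (1 / \<epsilon>)}"
  have "Q \<subseteq> {..nat \<lceil>2 powr (1 / \<epsilon>)\<rceil>}"
    unfolding Q_def by (auto simp: le_nat_iff) linarith
  then have finQ: "finite Q" using finite_subset by blast
  have K: "real e + 1 \<le> K * real p powr (\<epsilon> * real e)" if "prime p" for p e :: nat
  proof -
    have p2: "real p \<ge> 2" using prime_ge_2_nat[OF that] by simp
    have l2: "ln 2 > (0::real)" by simp
    have "1 + \<epsilon> * real e * ln 2 \<le> exp (\<epsilon> * real e * ln 2)" by (rule exp_ge_add_one_self)
    also have "\<dots> = 2 powr (\<epsilon> * real e)" by (simp add: powr_def)
    also have "\<dots> \<le> real p powr (\<epsilon> * real e)"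
      using p2 assms by (intro powr_mono2) auto
    finally have *: "1 + \<epsilon> * real e * ln 2 \<le> real p powr (\<epsilon> * real e)" .
    have "real e + 1 \<le> K * (1 + \<epsilon> * real e * ln 2)"
      using assms l2 by (simp add: K_def field_simps)
    also have "\<dots> \<le> K * real p powr (\<epsilon> * real e)"
      using * assms by (intro mult_left_mono) (auto simp: K_def)
    finally show ?thesis .
  qed
  show "K ^ card Q > 0" using assms by (auto simp: K_def intro!: zero_less_power add_pos_pos)
  fix n :: nat assume n: "n > 0"
  show "real (divisor_count n) \<le> K ^ card Q * real n powr \<epsilon>"
  proof (rule divisor_count_le_except_primes[OF finQ _ K n])
    fix p :: nat assume "prime p" "p \<notin> Q"
    then have "2 powr (1 / \<epsilon>) \<le> real p" by (simp add: Q_def)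
    then have "(2 powr (1 / \<epsilon>)) powr \<epsilon> \<le> real p powr \<epsilon>"
      using assms by (intro powr_mono2) auto
    then show "2 \<le> real p powr \<epsilon>" using assms by (simp add: powr_powr)
  qed (auto simp: Q_def)
qed

section \<open>Deletion from random subsets of prescribed size\<close>

text \<open>
  The left binomial coefficient counts the \<open>n\<close>-subsets of an \<open>N\<close>-set that contain \<open>a\<close> given
  elements. The inequality says that a uniformly random \<open>n\<close>-subset contains them with probability at
  most \<open>(n / N) ^ a\<close>, the value for independent choices: once some of the elements are
  known to be present, the next one is slightly less likely.
\<close>

lemma binomial_shift_le:
  assumes "a \<le> n" "n \<le> N"
  shows "(N - a choose (n - a)) * N ^ a \<le> n ^ a * (N choose n)"
  using assms(1)
proof (induction a)
  case 0
  then show ?case by simp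
next
  case (Suc a)
  obtain n' N' where n': "n - a = Suc n'" "N - a = Suc N'"
    using Suc.prems assms(2) by (metis Suc_diff_Suc Suc_le_eq less_le_trans)
  have absorb: "(N - a) * (N - Suc a choose (n - Suc a)) = (n - a) * (N - a choose (n - a))"
    using n' Suc_times_binomial_eq[of N' n'] by (simp add: diff_Suc mult.commute)
  have "(N - a) * ((N - Suc a choose (n - Suc a)) * N ^ Suc a)
      = (n - a) * N * ((N - a choose (n - a)) * N ^ a)"
    unfolding power_Suc by (metis absorb mult.assoc mult.left_commute)
  also have "\<dots> \<le> (n - a) * N * (n ^ a * (N choose n))"
    using Suc by (intro mult_left_mono) auto
  also have "\<dots> \<le> (N - a) * n * (n ^ a * (N choose n))"
  proof (rule mult_right_mono)
    show "(n - a) * N \<le> (N - a) * n"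
      unfolding diff_mult_distrib mult.commute[of n N]
      using assms(2) by (intro diff_le_mono2 mult_left_mono) auto
  qed simp
  also have "\<dots> = (N - a) * (n ^ Suc a * (N choose n))" by simp
  finally show ?case using n'(2) unfolding mult_le_cancel1 by simp
qed

lemma card_supersets:
  assumes "finite V" "S \<subseteq> V" "card S \<le> n"
  shows "card {P. S \<subseteq> P \<and> P \<subseteq> V \<and> card P = n} = (card V - card S choose (n - card S))"
proof -
  have finS: "finite S" using assms finite_subset by blast
  have "bij_betw (\<lambda>P. P - S) {P. S \<subseteq> P \<and> P \<subseteq> V \<and> card P = n}
          {Q. Q \<subseteq> V - S \<and> card Q = n - card S}"
  proof (rule bij_betw_byWitness[where f' = "\<lambda>Q. Q \<union> S"])
    show "(\<lambda>Q. Q \<union> S) ` {Q. Q \<subseteq> V - S \<and> card Q = n - card S}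
            \<subseteq> {P. S \<subseteq> P \<and> P \<subseteq> V \<and> card P = n}"
    proof clarify
      fix Q assume Q: "Q \<subseteq> V - S" "card Q = n - card S"
      then have "finite Q" using assms(1) finite_subset by blast
      then have "card (Q \<union> S) = n"
        using Q finS assms(3) by (subst card_Un_disjoint) auto
      then show "S \<subseteq> Q \<union> S \<and> Q \<union> S \<subseteq> V \<and> card (Q \<union> S) = n" using Q assms by auto
    qed
  qed (use assms finS in \<open>auto simp: card_Diff_subset\<close>)
  then have "card {P. S \<subseteq> P \<and> P \<subseteq> V \<and> card P = n} = card {Q. Q \<subseteq> V - S \<and> card Q = n - card S}"
    by (rule bij_betw_same_card)
  also have "\<dots> = (card V - card S choose (n - card S))"
    using assms finS by (simp add: n_subsets card_Diff_subset)
  finally show ?thesis .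
qed

lemma card_supersets_le:
  assumes "finite V" "S \<subseteq> V" "n \<le> card V" "card V > 0"
  shows "real (card {P. S \<subseteq> P \<and> P \<subseteq> V \<and> card P = n})
    \<le> (real n / real (card V)) ^ card S * real (card V choose n)"
proof (cases "card S \<le> n")
  case True
  have "real ((card V - card S choose (n - card S)) * card V ^ card S)
      \<le> real (n ^ card S * (card V choose n))"
    using binomial_shift_le[OF True assms(3)] by (simp only: of_nat_le_iff)
  then show ?thesis
    unfolding card_supersets[OF assms(1,2) True] using assms(4) by (simp add: field_simps)
next
  case False
  have "{P. S \<subseteq> P \<and> P \<subseteq> V \<and> card P = n} = {}"
    using False card_mono assms(1) finite_subset by blast
  show ?thesis unfolding \<open>{P. S \<subseteq> P \<and> P \<subseteq> V \<and> card P = n} = {}\<close> by simp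
qed

lemma card_subsets_containing:
  assumes "finite V" "v \<in> V" "n \<le> card V"
  shows "real (card {P. v \<in> P \<and> P \<subseteq> V \<and> card P = n})
    = real n / real (card V) * real (card V choose n)"
proof (cases n)
  case 0
  have "{P. v \<in> P \<and> P \<subseteq> V \<and> card P = n} = {}"
    using 0 assms(1) finite_subset by fastforce
  show ?thesis unfolding \<open>{P. v \<in> P \<and> P \<subseteq> V \<and> card P = n} = {}\<close> using 0 by simp
next
  case (Suc m)
  have pos: "card V > 0" using assms card_gt_0_iff by blast
  then obtain M where M: "card V = Suc M" by (metis gr0_implies_Suc)
  have "card {P. v \<in> P \<and> P \<subseteq> V \<and> card P = n} = (card V - 1 choose (n - 1))"
    using card_supersets[of V "{v}" n] assms Suc by simp
  moreover have "card V * (card V - 1 choose (n - 1)) = n * (card V choose n)"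
    using Suc_times_binomial_eq[of M m] by (simp add: M Suc mult.commute)
  then have "real (card V) * real (card V - 1 choose (n - 1)) = real n * real (card V choose n)"
    by (metis of_nat_mult)
  ultimately show ?thesis using pos by (simp add: field_simps)
qed

lemma exists_ge_average:
  fixes f :: "'a \<Rightarrow> real"
  assumes "finite X" "X \<noteq> {}" "t * real (card X) \<le> sum f X"
  shows "\<exists>x\<in>X. t \<le> f x"
proof (rule ccontr)
  assume "\<not> (\<exists>x\<in>X. t \<le> f x)"
  then have "sum f X < (\<Sum>x\<in>X. t)"
    using assms by (intro sum_strict_mono) auto
  then show False using assms by (simp add: mult.commute)
qed

text \<open>
  A random \<open>n\<close>-subset \<open>P\<close> of \<open>V\<close> and a random \<open>n\<close>-subset \<open>L\<close> of \<open>U\<close> span \<open>I q\<^sup>2\<close> incidences on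
  average, where \<open>I\<close> counts the incidences of \<open>V\<close> and \<open>U\<close>. Every forbidden pair \<open>(S, M)\<close> inside
  \<open>(P, L)\<close> is destroyed by deleting one vertex \<open>v\<close> of \<open>S\<close>, which loses as many incidences as
  \<open>v\<close> has neighbours in \<open>L\<close>. The expected loss is a sum over the neighbours \<open>l\<close> of \<open>v\<close> in \<open>U\<close>: if
  \<open>l \<in> M\<close>, the event has \<open>a + b\<close> required elements, otherwise \<open>a + b + 1\<close>. Some choice is at least
  as good as the average. Sampling sets of exactly \<open>n\<close> elements bounds the sizes of the outcome
  without any concentration estimate, and charging the deleted incidences directly to the forbidden pairs
  makes it unnecessary to control the degrees in the sample.
\<close>

theorem deletion_method:
  fixes V :: "'a set" and U :: "'b set" and R :: "'a \<Rightarrow> 'b \<Rightarrow> bool"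
  assumes fin: "finite V" "finite U" "finite F"
    and card: "card V = N" "card U = N" "n \<le> N" "N > 0"
    and F: "\<And>S M. (S, M) \<in> F \<Longrightarrow> S \<subseteq> V \<and> M \<subseteq> U \<and> S \<noteq> {} \<and> card S = a \<and> card M = b"
    and deg: "\<And>v. v \<in> V \<Longrightarrow> card {l \<in> U. R v l} \<le> D"
  defines "q \<equiv> real n / real N"
  shows "\<exists>P L. P \<subseteq> V \<and> L \<subseteq> U \<and> card P \<le> n \<and> card L \<le> n \<and>
      (\<forall>(S, M) \<in> F. \<not> (S \<subseteq> P \<and> M \<subseteq> L)) \<and>
      real (card {(v, l). v \<in> V \<and> l \<in> U \<and> R v l}) * q\<^sup>2
        - real (card F) * (real b * q ^ (a + b) + real D * q ^ (a + b + 1))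
      \<le> real (card {(v, l). v \<in> P \<and> l \<in> L \<and> R v l})"
proof -
  define c where "c = real (N choose n)"
  define VV where "VV = {P. P \<subseteq> V \<and> card P = n}"
  define UU where "UU = {L. L \<subseteq> U \<and> card L = n}"
  define pick where "pick S = (SOME v. v \<in> S)" for S :: "'a set"
  define inc where "inc P L = real (card {(v, l). v \<in> P \<and> l \<in> L \<and> R v l})" for P L
  define cost where "cost P L = (\<Sum>(S, M) \<in> F.
      if S \<subseteq> P \<and> M \<subseteq> L then real (card {l \<in> L. R (pick S) l}) else 0)" for P L
  define I where "I = {(v, l). v \<in> V \<and> l \<in> U \<and> R v l}"
  have cpos: "c > 0" using card by (simp add: c_def)
  have q0: "q \<ge> 0" by (simp add: q_def)
  have finVU: "finite VV" "finite UU" unfolding VV_def UU_def using fin by auto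
  have cardVU: "real (card VV) = c" "real (card UU) = c"
    unfolding VV_def UU_def c_def using fin card by (simp_all add: n_subsets)
  have finI: "finite I" unfolding I_def by (rule finite_subset[of _ "V \<times> U"]) (use fin in auto)
  have pick: "pick S \<in> S" if "S \<noteq> {}" for S using that unfolding pick_def by (simp add: some_in_eq)
  have supV: "real (card {P \<in> VV. S \<subseteq> P}) \<le> q ^ card S * c" if "S \<subseteq> V" for S
    using card_supersets_le[OF fin(1) that, of n] card
    unfolding VV_def c_def q_def by (simp add: conj_ac)
  have supU: "real (card {L \<in> UU. M \<subseteq> L}) \<le> q ^ card M * c" if "M \<subseteq> U" for M
    using card_supersets_le[OF fin(2) that, of n] card
    unfolding UU_def c_def q_def by (simp add: conj_ac)
  have oneV: "real (card {P \<in> VV. v \<in> P}) = q * c" if "v \<in> V" for v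
    using card_subsets_containing[OF fin(1) that, of n] card
    unfolding VV_def c_def q_def by (simp add: conj_ac)
  have oneU: "real (card {L \<in> UU. l \<in> L}) = q * c" if "l \<in> U" for l
    using card_subsets_containing[OF fin(2) that, of n] card
    unfolding UU_def c_def q_def by (simp add: conj_ac)
  \<comment> \<open>The two samples are independent.\<close>
  have prod_sum: "(\<Sum>(P, L) \<in> VV \<times> UU. (if A P \<and> B L then 1 else 0))
      = real (card {P \<in> VV. A P}) * real (card {L \<in> UU. B L})" for A B
  proof -
    have "(\<Sum>(P, L) \<in> VV \<times> UU. (if A P \<and> B L then 1 else 0)) =
        (\<Sum>P\<in>VV. \<Sum>L\<in>UU. (if A P then 1 else 0) * (if B L then 1 else (0::real)))"
      unfolding sum.cartesian_product by (intro sum.cong) auto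
    also have "\<dots> = (\<Sum>P\<in>VV. if A P then 1 else 0) * (\<Sum>L\<in>UU. if B L then 1 else 0)"
      by (simp add: sum_product)
    finally show ?thesis
      using finVU by (simp add: sum.If_cases Int_def)
  qed
  have inc_sum: "(\<Sum>(P, L) \<in> VV \<times> UU. inc P L) = real (card I) * (q * c)\<^sup>2"
  proof -
    have *: "inc P L = (\<Sum>(v, l)\<in>I. if v \<in> P \<and> l \<in> L then 1 else 0)"
      if "P \<in> VV" "L \<in> UU" for P L
    proof -
      have "{(v, l). v \<in> P \<and> l \<in> L \<and> R v l} = {x \<in> I. fst x \<in> P \<and> snd x \<in> L}"
        using that by (auto simp: I_def VV_def UU_def)
      then show ?thesis
        using finI by (simp add: inc_def case_prod_unfold sum.If_cases Int_def)
    qed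
    have "(\<Sum>(P, L) \<in> VV \<times> UU. inc P L)
        = (\<Sum>x \<in> VV \<times> UU. \<Sum>y\<in>I. if fst y \<in> fst x \<and> snd y \<in> snd x then 1 else 0)"
      by (intro sum.cong) (auto simp: * case_prod_unfold)
    also have "\<dots> = (\<Sum>y\<in>I. \<Sum>x \<in> VV \<times> UU. if fst y \<in> fst x \<and> snd y \<in> snd x then 1 else 0)"
      by (rule sum.swap)
    also have "\<dots> = (\<Sum>y\<in>I. (q * c) * (q * c))"
    proof (rule sum.cong)
      fix y assume "y \<in> I"
      then have "fst y \<in> V" "snd y \<in> U" by (auto simp: I_def)
      then show "(\<Sum>x \<in> VV \<times> UU. if fst y \<in> fst x \<and> snd y \<in> snd x then 1 else 0) = (q * c) * (q * c)"
        using prod_sum[of "\<lambda>P. fst y \<in> P" "\<lambda>L. snd y \<in> L"] oneV oneU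
        by (simp add: case_prod_unfold)
    qed simp
    finally show ?thesis by (simp add: power2_eq_square)
  qed
  have cost_sum: "(\<Sum>(P, L) \<in> VV \<times> UU. cost P L)
      \<le> real (card F) * (real b * q ^ (a + b) + real D * q ^ (a + b + 1)) * c\<^sup>2"
  proof -
    have "(\<Sum>(P, L) \<in> VV \<times> UU. cost P L) = (\<Sum>y\<in>F. \<Sum>x \<in> VV \<times> UU.
        if fst y \<subseteq> fst x \<and> snd y \<subseteq> snd x then real (card {l \<in> snd x. R (pick (fst y)) l}) else 0)"
      unfolding cost_def case_prod_unfold by (rule sum.swap)
    also have "\<dots> \<le> (\<Sum>y\<in>F. (real b * q ^ (a + b) + real D * q ^ (a + b + 1)) * c\<^sup>2)"
    proof (rule sum_mono)
      fix y assume y: "y \<in> F"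
      obtain S M where SM: "y = (S, M)" by (cases y)
      have SMp: "S \<subseteq> V" "M \<subseteq> U" "S \<noteq> {}" "card S = a" "card M = b"
        using F[of S M] y SM by auto
      define E where "E = {l \<in> U. R (pick S) l}"
      have finE: "finite E" and finM: "finite M"
        using fin SMp(2) finite_subset unfolding E_def by auto
      have cardE: "card E \<le> D" unfolding E_def using deg pick SMp by blast
      have "(\<Sum>x \<in> VV \<times> UU. if fst y \<subseteq> fst x \<and> snd y \<subseteq> snd x
              then real (card {l \<in> snd x. R (pick (fst y)) l}) else 0)
          = (\<Sum>x \<in> VV \<times> UU. \<Sum>l\<in>E. if S \<subseteq> fst x \<and> insert l M \<subseteq> snd x then 1 else 0)"
      proof (rule sum.cong)
        fix x assume x: "x \<in> VV \<times> UU"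
        then have "{l \<in> snd x. R (pick S) l} = {l \<in> E. l \<in> snd x}"
          by (auto simp: UU_def E_def)
        then show "(if fst y \<subseteq> fst x \<and> snd y \<subseteq> snd x
              then real (card {l \<in> snd x. R (pick (fst y)) l}) else 0)
            = (\<Sum>l\<in>E. if S \<subseteq> fst x \<and> insert l M \<subseteq> snd x then 1 else 0)"
          using finE by (auto simp: SM sum.If_cases Int_def)
      qed simp
      also have "\<dots> = (\<Sum>l\<in>E. \<Sum>x \<in> VV \<times> UU. if S \<subseteq> fst x \<and> insert l M \<subseteq> snd x then 1 else 0)"
        by (rule sum.swap)
      also have "\<dots> = (\<Sum>l\<in>E. real (card {P \<in> VV. S \<subseteq> P}) * real (card {L \<in> UU. insert l M \<subseteq> L}))"
        using prod_sum[of "\<lambda>P. S \<subseteq> P" "\<lambda>L. insert _ M \<subseteq> L"] by (simp only: case_prod_unfold)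
      also have "\<dots> \<le> (\<Sum>l\<in>E. (q ^ a * c) * (q ^ card (insert l M) * c))"
        using supV[OF SMp(1)] supU[of "insert _ M"] SMp q0 cpos
        by (intro sum_mono mult_mono) (auto simp: E_def)
      also have "\<dots> = (\<Sum>l\<in>E \<inter> M. q ^ (a + b) * c\<^sup>2) + (\<Sum>l\<in>E - M. q ^ (a + b + 1) * c\<^sup>2)"
        using finE finM SMp(5)
        by (subst sum.Int_Diff[of _ _ M])
          (auto simp: insert_absorb power_add power2_eq_square mult_ac intro!: arg_cong2[of _ _ _ _ "(+)"] sum.cong)
      also have "\<dots> = (real (card (E \<inter> M)) * q ^ (a + b) + real (card (E - M)) * q ^ (a + b + 1)) * c\<^sup>2"
        by (simp add: algebra_simps)
      also have "\<dots> \<le> (real b * q ^ (a + b) + real D * q ^ (a + b + 1)) * c\<^sup>2"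
      proof -
        have "card (E \<inter> M) \<le> b" using SMp(5) finM card_mono[of M "E \<inter> M"] by auto
        moreover have "card (E - M) \<le> D" using cardE finE card_mono[of E "E - M"] by auto
        ultimately show ?thesis
          using q0 by (intro mult_right_mono add_mono) auto
      qed
      finally show "(\<Sum>x \<in> VV \<times> UU. if fst y \<subseteq> fst x \<and> snd y \<subseteq> snd x
              then real (card {l \<in> snd x. R (pick (fst y)) l}) else 0)
          \<le> (real b * q ^ (a + b) + real D * q ^ (a + b + 1)) * c\<^sup>2" .
    qed
    finally show ?thesis by simp
  qed
  define t where "t = real (card I) * q\<^sup>2
        - real (card F) * (real b * q ^ (a + b) + real D * q ^ (a + b + 1))"
  have "\<exists>x\<in>VV \<times> UU. t \<le> inc (fst x) (snd x) - cost (fst x) (snd x)"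
  proof (rule exists_ge_average)
    show "VV \<times> UU \<noteq> {}" using cardVU cpos by auto
    have "t * real (card (VV \<times> UU)) = t * c\<^sup>2"
      using cardVU by (simp add: card_cartesian_product power2_eq_square)
    also have "\<dots> \<le> (\<Sum>x\<in>VV \<times> UU. inc (fst x) (snd x)) - (\<Sum>x\<in>VV \<times> UU. cost (fst x) (snd x))"
      using inc_sum cost_sum unfolding t_def
      by (simp add: case_prod_unfold power_mult_distrib algebra_simps)
    finally show "t * real (card (VV \<times> UU)) \<le> (\<Sum>x\<in>VV \<times> UU. inc (fst x) (snd x) - cost (fst x) (snd x))"
      by (simp add: sum_subtractf)
  qed (use finVU in auto)
  then obtain P L where PL: "P \<subseteq> V" "card P = n" "L \<subseteq> U" "card L = n" "t \<le> inc P L - cost P L"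
    by (auto simp: VV_def UU_def)
  have finPL: "finite P" "finite L" using PL fin finite_subset by blast+
  define H where "H = {y \<in> F. fst y \<subseteq> P \<and> snd y \<subseteq> L}"
  have finH: "finite H" using fin by (simp add: H_def)
  define P' where "P' = P - (pick \<circ> fst) ` H"
  have "inc P L \<le> inc P' L + cost P L"
  proof -
    let ?Z = "\<lambda>y. Pair (pick (fst y)) ` {l \<in> L. R (pick (fst y)) l}"
    have "{(v, l). v \<in> P \<and> l \<in> L \<and> R v l}
        \<subseteq> {(v, l). v \<in> P' \<and> l \<in> L \<and> R v l} \<union> (\<Union>y\<in>H. ?Z y)"
      by (auto simp: P'_def)
    moreover have "finite {(v, l). v \<in> P' \<and> l \<in> L \<and> R v l}"
      by (rule finite_subset[of _ "P \<times> L"]) (use finPL in \<open>auto simp: P'_def\<close>)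
    ultimately have "card {(v, l). v \<in> P \<and> l \<in> L \<and> R v l}
        \<le> card ({(v, l). v \<in> P' \<and> l \<in> L \<and> R v l} \<union> (\<Union>y\<in>H. ?Z y))"
      using finH finPL by (intro card_mono) auto
    also have "\<dots> \<le> card {(v, l). v \<in> P' \<and> l \<in> L \<and> R v l} + card (\<Union>y\<in>H. ?Z y)"
      by (rule card_Un_le)
    also have "card (\<Union>y\<in>H. ?Z y) \<le> (\<Sum>y\<in>H. card (?Z y))"
      using finH by (rule card_UN_le)
    also have "(\<Sum>y\<in>H. card (?Z y)) = (\<Sum>y\<in>H. card {l \<in> L. R (pick (fst y)) l})"
      by (simp add: card_image inj_on_def)
    finally have "inc P L \<le> inc P' L + (\<Sum>y\<in>H. real (card {l \<in> L. R (pick (fst y)) l}))"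
      by (simp add: inc_def flip: of_nat_sum of_nat_add)
    also have "(\<Sum>y\<in>H. real (card {l \<in> L. R (pick (fst y)) l})) = cost P L"
      unfolding cost_def H_def using fin(3) by (simp add: case_prod_unfold sum.inter_filter)
    finally show ?thesis .
  qed
  moreover have "\<forall>(S, M) \<in> F. \<not> (S \<subseteq> P' \<and> M \<subseteq> L)"
  proof clarify
    fix S M assume SM: "(S, M) \<in> F" "S \<subseteq> P'" "M \<subseteq> L"
    then have "(S, M) \<in> H" by (auto simp: H_def P'_def)
    then have "pick S \<notin> P'" by (force simp: P'_def)
    then show False using SM F pick by blast
  qed
  moreover have "card P' \<le> n" using PL finPL card_mono[of P P'] by (auto simp: P'_def)
  moreover have "P' \<subseteq> V" using PL by (auto simp: P'_def)
  ultimately show ?thesis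
    using PL unfolding t_def inc_def I_def by (intro exI[of _ P'] exI[of _ L]) auto
qed

section \<open>Labelling copies of a subdivided clique\<close>

text \<open>
  The combinatorial content of being isomorphic to a subdivided clique: it refers only to
  incidences within \<open>(P, L)\<close> and is therefore invariant under isomorphism, whereas the clause
  \<open>l \<inter> l' = {w}\<close> in the geometric definition also speaks of points outside the configuration.
\<close>

definition clique_copy :: "nat \<Rightarrow> 'a set \<Rightarrow> 'a set set \<Rightarrow> bool" where
  "clique_copy k P L \<longleftrightarrow>
     (\<exists>B W. P = B \<union> W \<and> B \<inter> W = {} \<and>
        card B = k \<and> card W = k choose 2 \<and> card L = 2 * (k choose 2) \<and>
        (\<forall>b\<in>B. \<forall>b'\<in>B. b \<noteq> b' \<longrightarrow>
           (\<exists>l\<in>L. \<exists>l'\<in>L. \<exists>w\<in>W. l \<noteq> l' \<and> b \<in> l \<and> b' \<in> l' \<and> w \<in> l \<and> w \<in> l')) \<and>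
        (\<forall>w\<in>W. card {l \<in> L. w \<in> l} = 2) \<and>
        (\<forall>l\<in>L. card (B \<inter> l) = 1 \<and> card (W \<inter> l) = 1))"

lemma clique_copy_if_contains:
  assumes "contains_subdivided_clique k P L"
  obtains P1 L1 where "P1 \<subseteq> P" "L1 \<subseteq> L" "clique_copy k P1 L1"
proof -
  obtain P1 L1 P0 L0 where sub: "P1 \<subseteq> P" "L1 \<subseteq> L"
    and clique: "subdivided_clique k P0 L0" and iso: "config_isomorphic P1 L1 P0 L0"
    using assms unfolding contains_subdivided_clique_def by blast
  obtain f g where f: "bij_betw f P1 P0" and g: "bij_betw g L1 L0"
    and "\<forall>p\<in>P1. \<forall>l\<in>L1. (p, l) \<in> incidences P1 L1 \<longleftrightarrow> (f p, g l) \<in> incidences P0 L0"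
    using iso unfolding config_isomorphic_def by blast
  then have fg: "p \<in> l \<longleftrightarrow> f p \<in> g l" if "p \<in> P1" "l \<in> L1" for p l
    using that bij_betwE[OF f] bij_betwE[OF g] unfolding incidences_def by blast
  obtain B W where BW: "P0 = B \<union> W" "B \<inter> W = {}" "card B = k" "card W = k choose 2"
    and L0: "card L0 = 2 * (k choose 2)"
    and paths: "\<forall>b\<in>B. \<forall>b'\<in>B. b \<noteq> b' \<longrightarrow>
           (\<exists>l\<in>L0. \<exists>l'\<in>L0. \<exists>w\<in>W. l \<noteq> l' \<and> b \<in> l \<and> b' \<in> l' \<and> l \<inter> l' = {w})"
    and white: "\<forall>w\<in>W. card {l \<in> L0. w \<in> l} = 2"
    and lines: "\<forall>l\<in>L0. card (B \<inter> l) = 1 \<and> card (W \<inter> l) = 1"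
    using clique unfolding subdivided_clique_def by (elim exE conjE) (rule that)
  define B1 where "B1 = {p \<in> P1. f p \<in> B}"
  define W1 where "W1 = {p \<in> P1. f p \<in> W}"
  have fsub: "bij_betw f {p \<in> P1. f p \<in> X} X" if "X \<subseteq> P0" for X
    using f that unfolding bij_betw_def by (auto simp: inj_on_def)
  have gsub: "bij_betw g {l \<in> L1. g l \<in> Y} Y" if "Y \<subseteq> L0" for Y
    using g that unfolding bij_betw_def by (auto simp: inj_on_def)
  have fB: "bij_betw f B1 B" and fW: "bij_betw f W1 W"
    using fsub BW unfolding B1_def W1_def by auto
  have copy: "clique_copy k P1 L1"
    unfolding clique_copy_def
  proof (rule exI[of _ B1], rule exI[of _ W1], intro conjI ballI impI)
    show "P1 = B1 \<union> W1" using BW bij_betwE[OF f] by (auto simp: B1_def W1_def)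
    show "B1 \<inter> W1 = {}" using BW by (auto simp: B1_def W1_def)
    show "card B1 = k" "card W1 = k choose 2" "card L1 = 2 * (k choose 2)"
      using bij_betw_same_card[OF fB] bij_betw_same_card[OF fW] bij_betw_same_card[OF g] BW L0
      by simp_all
  next
    fix b b' assume b: "b \<in> B1" "b' \<in> B1" "b \<noteq> b'"
    then have "f b \<in> B" "f b' \<in> B" "f b \<noteq> f b'"
      using f by (auto simp: B1_def bij_betw_def inj_on_def)
    from paths[rule_format, OF this] obtain l l' w where lw: "l \<in> L0" "l' \<in> L0" "w \<in> W" "l \<noteq> l'"
      "f b \<in> l" "f b' \<in> l'" "w \<in> l" "w \<in> l'" by blast
    obtain m where m: "m \<in> L1" "g m = l" using g lw by (auto simp: bij_betw_def)
    obtain m' where m': "m' \<in> L1" "g m' = l'" using g lw by (auto simp: bij_betw_def)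
    obtain v where v: "v \<in> W1" "f v = w" using fW lw by (auto simp: bij_betw_def)
    have "b \<in> P1" "b' \<in> P1" "v \<in> P1" using b v by (auto simp: B1_def W1_def)
    then have "b \<in> m" "b' \<in> m'" "v \<in> m" "v \<in> m'" using m m' v lw fg by auto
    moreover have "m \<noteq> m'" using m m' lw(4) by auto
    ultimately show "\<exists>l\<in>L1. \<exists>l'\<in>L1. \<exists>w\<in>W1. l \<noteq> l' \<and> b \<in> l \<and> b' \<in> l' \<and> w \<in> l \<and> w \<in> l'"
      using m(1) m'(1) v(1) by blast
  next
    fix w assume w: "w \<in> W1"
    then have "{l \<in> L1. w \<in> l} = {l \<in> L1. g l \<in> {l \<in> L0. f w \<in> l}}"
      using fg bij_betwE[OF g] by (auto simp: W1_def)
    then have "card {l \<in> L1. w \<in> l} = card {l \<in> L0. f w \<in> l}"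
      using bij_betw_same_card[OF gsub[of "{l \<in> L0. f w \<in> l}"]] by auto
    then show "card {l \<in> L1. w \<in> l} = 2" using white w by (simp add: W1_def)
  next
    fix l assume l: "l \<in> L1"
    have *: "card ({p \<in> P1. f p \<in> X} \<inter> l) = card (X \<inter> g l)" if "X \<subseteq> P0" for X
    proof -
      have "{p \<in> P1. f p \<in> X} \<inter> l = {p \<in> P1. f p \<in> X \<inter> g l}"
        using fg l by auto
      then show ?thesis using bij_betw_same_card[OF fsub[of "X \<inter> g l"]] that by auto
    qed
    have "g l \<in> L0" using bij_betwE[OF g] l by blast
    then show "card (B1 \<inter> l) = 1" "card (W1 \<inter> l) = 1"
      unfolding B1_def W1_def using *[of B] *[of W] BW(1) lines by simp_all
  qed
  show ?thesis using that[OF sub copy] .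
qed

lemma clique_copy_card:
  assumes "clique_copy k P L" "k \<ge> 3"
  shows "card P = k + (k choose 2)" "card L = 2 * (k choose 2)" "P \<noteq> {}"
proof -
  obtain B W where BW: "P = B \<union> W" "B \<inter> W = {}" "card B = k" "card W = k choose 2"
    "card L = 2 * (k choose 2)"
    using assms(1) unfolding clique_copy_def by (elim exE conjE) (rule that)
  have "k choose 2 > 0" using assms(2) by simp
  then have "finite B" "finite W" using BW assms(2) card_ge_0_finite by auto
  then show "card P = k + (k choose 2)" using BW by (simp add: card_Un_disjoint)
  then show "P \<noteq> {}" using assms(2) by auto
  show "card L = 2 * (k choose 2)" by fact
qed

text \<open>
  This is what makes it harmless to add isolated points and lines to a configuration.
\<close>

lemma clique_copy_not_isolated:
  assumes "clique_copy k P L" "k \<ge> 2"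
  shows "\<And>p. p \<in> P \<Longrightarrow> \<exists>l\<in>L. p \<in> l" "\<And>l. l \<in> L \<Longrightarrow> \<exists>p\<in>P. p \<in> l"
proof -
  obtain B W where BW: "P = B \<union> W" "card B = k"
    and paths: "\<forall>b\<in>B. \<forall>b'\<in>B. b \<noteq> b' \<longrightarrow>
           (\<exists>l\<in>L. \<exists>l'\<in>L. \<exists>w\<in>W. l \<noteq> l' \<and> b \<in> l \<and> b' \<in> l' \<and> w \<in> l \<and> w \<in> l')"
    and white: "\<forall>w\<in>W. card {l \<in> L. w \<in> l} = 2"
    and lines: "\<forall>l\<in>L. card (B \<inter> l) = 1 \<and> card (W \<inter> l) = 1"
    using assms(1) unfolding clique_copy_def by (elim exE conjE) (rule that)
  show "\<exists>l\<in>L. p \<in> l" if "p \<in> P" for p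
  proof (cases "p \<in> W")
    case True
    then have "{l \<in> L. p \<in> l} \<noteq> {}" using white by (metis card.empty zero_neq_numeral)
    then show ?thesis by blast
  next
    case False
    then have p: "p \<in> B" using that BW by simp
    have "\<not> B \<subseteq> {p}"
    proof
      assume "B \<subseteq> {p}"
      then have "card B \<le> 1" using card_mono[of "{p}" B] by simp
      then show False using BW assms(2) by simp
    qed
    then obtain b' where "b' \<in> B" "p \<noteq> b'" by blast
    then show ?thesis using paths[rule_format, OF p] by blast
  qed
  show "\<exists>p\<in>P. p \<in> l" if "l \<in> L" for l
  proof -
    have "B \<inter> l \<noteq> {}" using lines that by (metis card.empty zero_neq_one)
    then show ?thesis using BW by blast
  qed
qed

definition index_pairs :: "nat \<Rightarrow> (nat \<times> nat) set" where
  "index_pairs k = {(i, j). i < j \<and> j < k}"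

lemma finite_index_pairs [simp]: "finite (index_pairs k)"
  by (rule finite_subset[of _ "{..<k} \<times> {..<k}"]) (auto simp: index_pairs_def)

lemma card_index_pairs: "card (index_pairs k) = k choose 2"
proof (induction k)
  case 0
  then show ?case by (simp add: index_pairs_def)
next
  case (Suc k)
  have "index_pairs (Suc k) = index_pairs k \<union> (\<lambda>i. (i, k)) ` {..<k}"
    by (auto simp: index_pairs_def less_Suc_eq)
  moreover have "index_pairs k \<inter> (\<lambda>i. (i, k)) ` {..<k} = {}"
    by (auto simp: index_pairs_def)
  moreover have "card ((\<lambda>i. (i, k)) ` {..<k}) = k"
    by (simp add: card_image inj_on_def)
  ultimately show ?case
    using Suc by (simp add: card_Un_disjoint numeral_2_eq_2)
qed

text \<open>
  The ways to join two black points \<open>b\<close> and \<open>b'\<close> through a white point \<open>w\<close>. The condition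
  \<open>w \<noteq> b\<close> lets \<open>b\<close> and \<open>w\<close> determine the first line.
\<close>

definition two_line_paths :: "'a set \<Rightarrow> 'a set set \<Rightarrow> 'a \<Rightarrow> 'a \<Rightarrow> ('a set \<times> 'a \<times> 'a set) set" where
  "two_line_paths V U b b' = {(l, w, l'). l \<in> U \<and> w \<in> V \<and> l' \<in> U \<and> l \<noteq> l' \<and> w \<noteq> b \<and>
      b \<in> l \<and> w \<in> l \<and> w \<in> l' \<and> b' \<in> l'}"

lemma finite_two_line_paths:
  assumes "finite V" "finite U"
  shows "finite (two_line_paths V U b b')"
  by (rule finite_subset[of _ "U \<times> V \<times> U"]) (use assms in \<open>auto simp: two_line_paths_def\<close>)

text \<open>
  The vertex sets of a copy, recovered from an enumeration \<open>b\<close> of its black points and a path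
  \<open>h (i, j)\<close> for each pair of indices \<open>i < j\<close>.
\<close>

definition assemble ::
  "nat \<Rightarrow> (nat \<Rightarrow> 'a) \<times> (nat \<times> nat \<Rightarrow> 'a set \<times> 'a \<times> 'a set) \<Rightarrow> 'a set \<times> 'a set set" where
  "assemble k = (\<lambda>(b, h). (b ` {..<k} \<union> (\<lambda>e. fst (snd (h e))) ` index_pairs k,
      (\<lambda>e. fst (h e)) ` index_pairs k \<union> (\<lambda>e. snd (snd (h e))) ` index_pairs k))"

text \<open>
  Choose a path for each pair of black points. A white point lies on just two lines and each
  line has just one black point, so the white point of a path determines the path's end points. Hence
  different pairs use different white points, and there being \<open>k choose 2\<close> of each, all white points
  occur. Since each line passes through a white point and only the two lines of the corresponding
  path pass through that point, all lines occur as well.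
\<close>

lemma clique_copy_assembled:
  assumes copy: "clique_copy k P L" and k: "k \<ge> 3" and sub: "P \<subseteq> V" "L \<subseteq> U"
  shows "\<exists>b\<in>{..<k} \<rightarrow>\<^sub>E V. inj_on b {..<k} \<and>
    (\<exists>h\<in>(\<Pi>\<^sub>E e\<in>index_pairs k. two_line_paths V U (b (fst e)) (b (snd e))).
       (P, L) = assemble k (b, h))"
proof -
  obtain B W where BW: "P = B \<union> W" "B \<inter> W = {}" "card B = k" "card W = k choose 2"
    and paths: "\<forall>b\<in>B. \<forall>b'\<in>B. b \<noteq> b' \<longrightarrow>
           (\<exists>l\<in>L. \<exists>l'\<in>L. \<exists>w\<in>W. l \<noteq> l' \<and> b \<in> l \<and> b' \<in> l' \<and> w \<in> l \<and> w \<in> l')"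
    and white: "\<forall>w\<in>W. card {l \<in> L. w \<in> l} = 2"
    and lines: "\<forall>l\<in>L. card (B \<inter> l) = 1 \<and> card (W \<inter> l) = 1"
    using copy unfolding clique_copy_def by (elim exE conjE) (rule that)
  have "k choose 2 > 0" using k by simp
  then have fin: "finite B" "finite W" using BW k card_ge_0_finite by auto
  obtain b0 where b0: "bij_betw b0 {..<k} B"
    using ex_bij_betw_nat_finite[OF fin(1)] BW by (auto simp: atLeast0LessThan)
  define b where "b = restrict b0 {..<k}"
  have b: "bij_betw b {..<k} B" using b0 unfolding b_def by (simp add: bij_betw_restrict_eq)
  have bB: "b i \<in> B" if "i < k" for i using bij_betwE[OF b] that by auto
  have bne: "b i \<noteq> b j" if "i < k" "j < k" "i \<noteq> j" for i j
    using b that by (auto simp: bij_betw_def inj_on_def)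
  have "\<forall>e\<in>index_pairs k. \<exists>t. fst t \<in> L \<and> snd (snd t) \<in> L \<and> fst (snd t) \<in> W \<and>
      fst t \<noteq> snd (snd t) \<and> b (fst e) \<in> fst t \<and> b (snd e) \<in> snd (snd t) \<and>
      fst (snd t) \<in> fst t \<and> fst (snd t) \<in> snd (snd t)"
  proof
    fix e assume "e \<in> index_pairs k"
    then have lt: "fst e < k" "snd e < k" "fst e \<noteq> snd e" by (auto simp: index_pairs_def)
    from paths[rule_format, OF bB[OF lt(1)] bB[OF lt(2)] bne[OF lt]]
    obtain l l' w where "l\<in>L" "l'\<in>L" "w\<in>W" "l \<noteq> l'" "b (fst e) \<in> l" "b (snd e) \<in> l'" "w \<in> l" "w \<in> l'"
      by blast
    then show "\<exists>t. fst t \<in> L \<and> snd (snd t) \<in> L \<and> fst (snd t) \<in> W \<and>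
      fst t \<noteq> snd (snd t) \<and> b (fst e) \<in> fst t \<and> b (snd e) \<in> snd (snd t) \<and>
      fst (snd t) \<in> fst t \<and> fst (snd t) \<in> snd (snd t)"
      by (intro exI[of _ "(l, w, l')"]) simp
  qed
  from bchoice[OF this] obtain h0 where h0: "\<forall>e\<in>index_pairs k. fst (h0 e) \<in> L \<and> snd (snd (h0 e)) \<in> L \<and>
      fst (snd (h0 e)) \<in> W \<and> fst (h0 e) \<noteq> snd (snd (h0 e)) \<and>
      b (fst e) \<in> fst (h0 e) \<and> b (snd e) \<in> snd (snd (h0 e)) \<and>
      fst (snd (h0 e)) \<in> fst (h0 e) \<and> fst (snd (h0 e)) \<in> snd (snd (h0 e))" ..
  define h where "h = restrict h0 (index_pairs k)"
  define l1 where "l1 e = fst (h e)" for e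
  define w where "w e = fst (snd (h e))" for e
  define l2 where "l2 e = snd (snd (h e))" for e
  have h: "l1 e \<in> L" "l2 e \<in> L" "w e \<in> W" "l1 e \<noteq> l2 e" "b (fst e) \<in> l1 e" "b (snd e) \<in> l2 e"
      "w e \<in> l1 e" "w e \<in> l2 e" if "e \<in> index_pairs k" for e
    using h0[rule_format, OF that] that by (simp_all add: l1_def l2_def w_def h_def)
  have lines_w: "{l \<in> L. w e \<in> l} = {l1 e, l2 e}" if e: "e \<in> index_pairs k" for e
  proof (rule sym, rule card_subset_eq)
    have "card {l \<in> L. w e \<in> l} = 2" using white h(3)[OF e] by blast
    then show "finite {l \<in> L. w e \<in> l}" "card {l1 e, l2 e} = card {l \<in> L. w e \<in> l}"
      using h(4)[OF e] card_ge_0_finite by auto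
  qed (use h[OF e] in auto)
  have black: "B \<inter> l = {p}" if lp: "l \<in> L" "p \<in> B" "p \<in> l" for l p
  proof -
    obtain x where x: "B \<inter> l = {x}"
      using lines[rule_format, OF lp(1), THEN conjunct1] by (rule card_1_singletonE)
    moreover have "p \<in> B \<inter> l" using lp(2,3) by simp
    ultimately show ?thesis by simp
  qed
  have inj_w: "inj_on w (index_pairs k)"
  proof (rule inj_onI)
    fix e e' assume e: "e \<in> index_pairs k" "e' \<in> index_pairs k" "w e = w e'"
    have lt: "fst e < snd e" "snd e < k" "fst e' < snd e'" "snd e' < k"
      using e by (auto simp: index_pairs_def)
    \<comment> \<open>The black points that share a line with a white point are the end points of its path.\<close>
    have bl: "(\<Union>l\<in>{l \<in> L. w d \<in> l}. B \<inter> l) = {b (fst d), b (snd d)}" if d: "d \<in> index_pairs k" for d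
    proof -
      have "fst d < k" "snd d < k" using d by (auto simp: index_pairs_def)
      then have "B \<inter> l1 d = {b (fst d)}" "B \<inter> l2 d = {b (snd d)}"
        using black h[OF d] bB by blast+
      then show ?thesis unfolding lines_w[OF d] by (simp add: insert_commute)
    qed
    have "{b (fst e), b (snd e)} = {b (fst e'), b (snd e')}"
      using bl[OF e(1)] bl[OF e(2)] unfolding e(3) by simp
    moreover have "b i = b j \<longleftrightarrow> i = j" if "i < k" "j < k" for i j
      using bne that by blast
    moreover have "fst e < k" "fst e' < k" using lt by simp_all
    ultimately have "fst e = fst e' \<and> snd e = snd e' \<or> fst e = snd e' \<and> snd e = fst e'"
      using lt(2,4) by (simp only: doubleton_eq_iff)
    then show "e = e'" using lt(1,3) by (auto simp: prod_eq_iff)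
  qed
  have W: "w ` index_pairs k = W"
    using fin(2) h(3) inj_w by (intro card_subset_eq) (auto simp: card_image card_index_pairs BW)
  have L: "L = l1 ` index_pairs k \<union> l2 ` index_pairs k"
  proof (intro equalityI subsetI)
    fix l assume l: "l \<in> L"
    then obtain v where "v \<in> W" "v \<in> l" using lines[rule_format, OF l] by (auto simp: card_1_singleton_iff)
    then obtain e where e: "e \<in> index_pairs k" "v = w e" using W by blast
    then have "l \<in> {l1 e, l2 e}" using lines_w[OF e(1)] l \<open>v \<in> l\<close> by blast
    then show "l \<in> l1 ` index_pairs k \<union> l2 ` index_pairs k" using e by blast
  qed (use h in auto)
  have "b ` {..<k} = B" using b by (simp add: bij_betw_def)
  then have "(P, L) = assemble k (b, h)"
    using BW W L by (simp add: assemble_def l1_def l2_def w_def)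
  moreover have "b \<in> {..<k} \<rightarrow>\<^sub>E V"
    using bB sub(1) unfolding BW(1) b_def by auto
  moreover have "inj_on b {..<k}" using b by (simp add: bij_betw_def)
  moreover have "h \<in> (\<Pi>\<^sub>E e\<in>index_pairs k. two_line_paths V U (b (fst e)) (b (snd e)))"
  proof (rule PiE_I)
    fix e assume e: "e \<in> index_pairs k"
    have "fst e < k" using e by (auto simp: index_pairs_def)
    then have "w e \<noteq> b (fst e)" using bB[of "fst e"] h(3)[OF e] BW(2) by (metis IntI emptyE)
    moreover have "h e = (l1 e, w e, l2 e)" by (simp add: l1_def l2_def w_def)
    ultimately show "h e \<in> two_line_paths V U (b (fst e)) (b (snd e))"
      using h[OF e] subsetD[OF sub(1), of "w e"] subsetD[OF sub(2)] BW(1) by (simp add: two_line_paths_def)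
  qed (simp add: h_def)
  ultimately show ?thesis by blast
qed

text \<open>
  There are at most \<open>card V ^ k\<close> enumerations of the black points, and at most \<open>t\<close> paths for each of the
  \<open>k choose 2\<close> pairs.
\<close>

theorem card_clique_copies_le:
  assumes fin: "finite V" "finite U" and k: "k \<ge> 3"
    and paths: "\<And>b b'. b \<in> V \<Longrightarrow> b' \<in> V \<Longrightarrow> b \<noteq> b' \<Longrightarrow> card (two_line_paths V U b b') \<le> t"
  shows "card {(P, L). P \<subseteq> V \<and> L \<subseteq> U \<and> clique_copy k P L} \<le> card V ^ k * t ^ (k choose 2)"
proof -
  define X where "X = {b \<in> {..<k} \<rightarrow>\<^sub>E V. inj_on b {..<k}}"
  define Y where "Y b = (\<Pi>\<^sub>E e\<in>index_pairs k. two_line_paths V U (b (fst e)) (b (snd e)))"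
    for b :: "nat \<Rightarrow> 'a"
  have finX: "finite X" unfolding X_def using fin by (simp add: finite_PiE)
  have finY: "finite (Y b)" for b
    unfolding Y_def using fin by (intro finite_PiE finite_two_line_paths) auto
  have "{(P, L). P \<subseteq> V \<and> L \<subseteq> U \<and> clique_copy k P L} \<subseteq> assemble k ` (SIGMA b:X. Y b)"
  proof clarify
    fix P L assume "P \<subseteq> V" "L \<subseteq> U" "clique_copy k P L"
    from clique_copy_assembled[OF this(3) k this(1,2)]
    show "(P, L) \<in> assemble k ` (SIGMA b:X. Y b)"
      unfolding X_def Y_def by blast
  qed
  then have "card {(P, L). P \<subseteq> V \<and> L \<subseteq> U \<and> clique_copy k P L} \<le> card (SIGMA b:X. Y b)"
    using finX finY by (meson card_image_le card_mono finite_SigmaI finite_imageI le_trans)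
  also have "\<dots> = (\<Sum>b\<in>X. card (Y b))" using finX finY by simp
  also have "\<dots> \<le> (\<Sum>b\<in>X. t ^ (k choose 2))"
  proof (rule sum_mono)
    fix b assume b: "b \<in> X"
    have "card (Y b) = (\<Prod>e\<in>index_pairs k. card (two_line_paths V U (b (fst e)) (b (snd e))))"
      unfolding Y_def by (simp add: card_PiE)
    also have "\<dots> \<le> (\<Prod>e\<in>index_pairs k. t)"
    proof (intro prod_mono conjI)
      fix e assume "e \<in> index_pairs k"
      then have "fst e < k" "snd e < k" "fst e \<noteq> snd e" by (auto simp: index_pairs_def)
      then show "card (two_line_paths V U (b (fst e)) (b (snd e))) \<le> t"
        using b by (intro paths) (auto simp: X_def inj_on_def)
    qed simp
    finally show "card (Y b) \<le> t ^ (k choose 2)" by (simp add: card_index_pairs)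
  qed
  also have "\<dots> = card X * t ^ (k choose 2)" by simp
  also have "card X \<le> card ({..<k} \<rightarrow>\<^sub>E V)"
    unfolding X_def using fin by (intro card_mono finite_PiE) auto
  also have "card ({..<k} \<rightarrow>\<^sub>E V) = card V ^ k" by (simp add: card_PiE)
  finally show ?thesis by simp
qed

section \<open>A grid with few two-line paths\<close>

definition grid_point :: "nat \<Rightarrow> nat \<Rightarrow> point" where
  "grid_point x y = vector [real x, real y]"

definition slope_line :: "nat \<Rightarrow> nat \<Rightarrow> point set" where
  "slope_line m c = {v. v $ 2 = real m * v $ 1 + real c}"

text \<open>
  The ranges for \<open>y\<close> and \<open>c\<close> are equal in order to have as many points as lines; the factor 2 leaves
  room for \<open>m * x + c\<close> when \<open>c < A\<^sup>2\<close>.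
\<close>

definition grid :: "nat \<Rightarrow> point set" where
  "grid A = (\<lambda>(x, y). grid_point x y) ` ({..<A} \<times> {..<2 * A\<^sup>2})"

definition grid_lines :: "nat \<Rightarrow> point set set" where
  "grid_lines A = (\<lambda>(m, c). slope_line m c) ` ({..<A} \<times> {..<2 * A\<^sup>2})"

lemma grid_point_on_slope_line [simp]:
  "grid_point x y \<in> slope_line m c \<longleftrightarrow> y = m * x + c"
  unfolding grid_point_def slope_line_def
  by (simp flip: of_nat_mult of_nat_add del: of_nat_add of_nat_mult)

lemma grid_point_eq_iff [simp]: "grid_point x y = grid_point x' y' \<longleftrightarrow> x = x' \<and> y = y'"
  by (auto simp: grid_point_def vec_eq_iff forall_2)

lemma slope_line_eq_iff [simp]: "slope_line m c = slope_line m' c' \<longleftrightarrow> m = m' \<and> c = c'"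
proof
  assume eq: "slope_line m c = slope_line m' c'"
  have "grid_point 0 c \<in> slope_line m' c'" "grid_point 1 (m + c) \<in> slope_line m' c'"
    unfolding eq[symmetric] by simp_all
  then show "m = m' \<and> c = c'" by simp
qed simp

lemma is_line_slope_line: "is_line (slope_line m c)"
proof -
  let ?a = "vector [- real m, 1] :: real ^ 2"
  have eq: "slope_line m c = {v. ?a \<bullet> v = real c}"
    by (auto simp: slope_line_def inner_vec_def sum_2)
  have "?a \<noteq> 0" by (auto simp: vec_eq_iff forall_2)
  then show ?thesis unfolding is_line_def eq by (simp add: affine_hyperplane)
qed

lemma finite_grid [simp]: "finite (grid A)" "finite (grid_lines A)"
  by (simp_all add: grid_def grid_lines_def)

lemma card_grid: "card (grid A) = 2 * A ^ 3" "card (grid_lines A) = 2 * A ^ 3"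
proof -
  have "card ({..<A} \<times> {..<2 * A\<^sup>2}) = 2 * A ^ 3"
    by (simp add: power2_eq_square power3_eq_cube)
  moreover have "inj_on (\<lambda>(x, y). grid_point x y) Z" "inj_on (\<lambda>(m, c). slope_line m c) Z" for Z
    by (auto simp: inj_on_def)
  ultimately show "card (grid A) = 2 * A ^ 3" "card (grid_lines A) = 2 * A ^ 3"
    by (simp_all only: grid_def grid_lines_def card_image)
qed

text \<open>
  For \<open>x, m < A\<close> and \<open>c < A\<^sup>2\<close> the ordinate \<open>m * x + c\<close> stays within the grid.
\<close>

lemma card_grid_incidences_ge:
  "A ^ 4 \<le> card {(v, l). v \<in> grid A \<and> l \<in> grid_lines A \<and> v \<in> l}"
proof -
  define f where "f = (\<lambda>(x, m, c). (grid_point x (m * x + c), slope_line m c))"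
  have "inj_on f ({..<A} \<times> {..<A} \<times> {..<A\<^sup>2})" by (auto simp: f_def inj_on_def)
  then have "card (f ` ({..<A} \<times> {..<A} \<times> {..<A\<^sup>2})) = A ^ 4"
    by (simp add: card_image power2_eq_square power4_eq_xxxx)
  moreover have "card (f ` ({..<A} \<times> {..<A} \<times> {..<A\<^sup>2}))
      \<le> card {(v, l). v \<in> grid A \<and> l \<in> grid_lines A \<and> v \<in> l}"
  proof (rule card_mono)
    show "finite {(v, l). v \<in> grid A \<and> l \<in> grid_lines A \<and> v \<in> l}"
      by (rule finite_subset[of _ "grid A \<times> grid_lines A"]) auto
    show "f ` ({..<A} \<times> {..<A} \<times> {..<A\<^sup>2})
      \<subseteq> {(v, l). v \<in> grid A \<and> l \<in> grid_lines A \<and> v \<in> l}"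
    proof (rule image_subsetI)
      fix z assume "z \<in> {..<A} \<times> {..<A} \<times> {..<A\<^sup>2}"
      then obtain x m c where z: "z = (x, m, c)" and xmc: "x < A" "m < A" "c < A\<^sup>2" by auto
      then have "m * x \<le> A * A" by (intro mult_mono) auto
      with xmc show "f z \<in> {(v, l). v \<in> grid A \<and> l \<in> grid_lines A \<and> v \<in> l}"
        by (auto simp: z f_def grid_def grid_lines_def power2_eq_square)
    qed
  qed
  ultimately show ?thesis by simp
qed

lemma card_grid_lines_through_le:
  assumes "v \<in> grid A"
  shows "card {l \<in> grid_lines A. v \<in> l} \<le> A"
proof -
  obtain x y where v: "v = grid_point x y" using assms by (auto simp: grid_def)
  have "{l \<in> grid_lines A. v \<in> l} \<subseteq> (\<lambda>m. slope_line m (y - m * x)) ` {..<A}"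
  proof clarify
    fix l assume "l \<in> grid_lines A" "v \<in> l"
    then obtain m c where "l = slope_line m c" "m < A" "y = m * x + c"
      by (auto simp: grid_lines_def v)
    then show "l \<in> (\<lambda>m. slope_line m (y - m * x)) ` {..<A}" by (intro image_eqI[of _ _ m]) simp_all
  qed
  then have "card {l \<in> grid_lines A. v \<in> l} \<le> card {..<A}"
    by (meson card_image_le card_mono finite_imageI finite_lessThan le_trans)
  then show ?thesis by simp
qed

lemma card_int_divisors_le:
  fixes K :: int
  assumes "K \<noteq> 0"
  shows "finite {d. d dvd K}" "card {d. d dvd K} \<le> 2 * divisor_count (nat \<bar>K\<bar>)"
proof -
  let ?D = "{d. d dvd nat \<bar>K\<bar>}"
  have finD: "finite ?D" using assms by (intro finite_divisors_nat) simp
  have sub: "{d. d dvd K} \<subseteq> int ` ?D \<union> (\<lambda>d. - int d) ` ?D"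
  proof
    fix d assume "d \<in> {d. d dvd K}"
    then have "nat \<bar>d\<bar> \<in> ?D" by (simp add: nat_dvd_iff)
    moreover have "d = int (nat \<bar>d\<bar>) \<or> d = - int (nat \<bar>d\<bar>)" by linarith
    ultimately show "d \<in> int ` ?D \<union> (\<lambda>d. - int d) ` ?D" by blast
  qed
  then show "finite {d. d dvd K}" using finD finite_subset by blast
  have "card {d. d dvd K} \<le> card (int ` ?D \<union> (\<lambda>d. - int d) ` ?D)"
    using sub finD by (intro card_mono) auto
  also have "\<dots> \<le> card (int ` ?D) + card ((\<lambda>d. - int d) ` ?D)" by (rule card_Un_le)
  also have "\<dots> \<le> card ?D + card ?D"
    using finD by (intro add_mono card_image_le)
  finally show "card {d. d dvd K} \<le> 2 * divisor_count (nat \<bar>K\<bar>)"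
    by (simp add: divisor_count_def)
qed

text \<open>
  Let \<open>b = (x\<^sub>1, y\<^sub>1)\<close> and \<open>b' = (x\<^sub>2, y\<^sub>2)\<close>, and let a path use the slopes \<open>m\<^sub>1\<close>, \<open>m\<^sub>2\<close> and the
  middle point \<open>(x, y)\<close>. Eliminating \<open>y\<close> gives
  \<open>(m\<^sub>2 - m\<^sub>1) (x - x\<^sub>1) = y\<^sub>1 - y\<^sub>2 + m\<^sub>2 (x\<^sub>2 - x\<^sub>1)\<close>. Both factors on the left are nonzero: two
  lines of equal slope through the middle point would coincide, and the middle point differs from \<open>b\<close>
  although it shares a line with it. So for each of the \<open>A\<close> values of \<open>m\<^sub>2\<close>, the signed number
  \<open>x - x\<^sub>1\<close> is one of at most \<open>2 * T\<close> divisors of the right-hand side, and \<open>m\<^sub>2\<close> and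
  \<open>x - x\<^sub>1\<close> determine the path.
\<close>

theorem card_grid_two_line_paths_le:
  assumes T: "\<And>j. 0 < j \<Longrightarrow> j \<le> A\<^sup>2 \<Longrightarrow> divisor_count j \<le> T"
    and b: "b \<in> grid A" "b' \<in> grid A"
  shows "card (two_line_paths (grid A) (grid_lines A) b b') \<le> A * (2 * T)"
proof -
  obtain x1 y1 where b1: "b = grid_point x1 y1" using b by (auto simp: grid_def)
  obtain x2 y2 where b2: "b' = grid_point x2 y2" using b by (auto simp: grid_def)
  \<comment> \<open>The integer that is factored; it depends only on the end points and the second slope.\<close>
  define K where "K m = int y1 - int y2 + int m * (int x2 - int x1)" for m
  define D where "D m = (if K m \<noteq> 0 \<and> \<bar>K m\<bar> \<le> int (A\<^sup>2) then {d. d dvd K m} else {})" for m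
  \<comment> \<open>The path is recovered from the second slope \<open>m\<close> and from the difference \<open>d\<close> of
    the abscissas of its middle point and \<open>b\<close>; on such data no subtraction truncates and the
    division is exact.\<close>
  define rebuild where "rebuild = (\<lambda>(m, d).
      let x = nat (int x1 + d); c = y2 - m * x2; y = m * x + c;
        m' = nat ((int y - int y1) div d)
      in (slope_line m' (y1 - m' * x1), grid_point x y, slope_line m c))"
  have "two_line_paths (grid A) (grid_lines A) b b' \<subseteq> rebuild ` (SIGMA m:{..<A}. D m)"
  proof (rule subsetI)
    fix t assume t: "t \<in> two_line_paths (grid A) (grid_lines A) b b'"
    obtain l w l' where tl: "t = (l, w, l')" by (metis prod_cases3)
    have t': "l \<in> grid_lines A" "w \<in> grid A" "l' \<in> grid_lines A" "l \<noteq> l'" "w \<noteq> b"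
      "b \<in> l" "w \<in> l" "w \<in> l'" "b' \<in> l'"
      using t by (auto simp: two_line_paths_def tl)
    obtain x y where w: "w = grid_point x y" "x < A" using t' by (auto simp: grid_def)
    obtain m1 c1 where l: "l = slope_line m1 c1" "m1 < A" using t' by (auto simp: grid_lines_def)
    obtain m2 c2 where l': "l' = slope_line m2 c2" "m2 < A" using t' by (auto simp: grid_lines_def)
    have x1: "x1 < A" using b(1) by (auto simp: b1 grid_def)
    have e: "y1 = m1 * x1 + c1" "y = m1 * x + c1" "y = m2 * x + c2" "y2 = m2 * x2 + c2"
      using t' by (auto simp: w l l' b1 b2)
    have m: "m1 \<noteq> m2"
    proof
      assume "m1 = m2"
      moreover have "c1 = c2" using e(2,3) unfolding \<open>m1 = m2\<close> by simp
      ultimately show False using t'(4) by (simp add: l l')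
    qed
    have x: "x \<noteq> x1" using t'(5) e(1,2) by (auto simp: w b1)
    have e': "int y1 = int m1 * int x1 + int c1" "int y = int m1 * int x + int c1"
        "int y = int m2 * int x + int c2" "int y2 = int m2 * int x2 + int c2"
      using e by (simp_all flip: of_nat_mult of_nat_add del: of_nat_mult of_nat_add)
    have K: "K m2 = (int m2 - int m1) * (int x - int x1)"
      using e' unfolding K_def by algebra
    have "\<bar>K m2\<bar> \<le> int A * int A"
      unfolding K abs_mult using w l l' x1 by (intro mult_mono) auto
    then have "int x - int x1 \<in> D m2"
      using m x K by (simp add: D_def power2_eq_square)
    moreover have "rebuild (m2, int x - int x1) = t"
    proof -
      have "int y - int y1 = int m1 * (int x - int x1)"
        using e'(1,2) by algebra
      then have "(int y - int y1) div (int x - int x1) = int m1" using x by simp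
      moreover have "y2 - m2 * x2 = c2" "y1 - m1 * x1 = c1" using e by simp_all
      ultimately show ?thesis
        unfolding rebuild_def Let_def case_prod_conv using e by (simp add: tl l l' w)
    qed
    ultimately show "t \<in> rebuild ` (SIGMA m:{..<A}. D m)" using l' by (intro image_eqI) auto
  qed
  moreover have finD: "finite (D m)" and cardD: "card (D m) \<le> 2 * T" for m
  proof -
    show "finite (D m)" using card_int_divisors_le(1) by (auto simp: D_def)
    show "card (D m) \<le> 2 * T"
    proof (cases "K m \<noteq> 0 \<and> \<bar>K m\<bar> \<le> int (A\<^sup>2)")
      case True
      then have "divisor_count (nat \<bar>K m\<bar>) \<le> T" by (intro T) (auto simp: nat_le_iff)
      then show ?thesis using True card_int_divisors_le(2)[of "K m"] by (simp add: D_def)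
    qed (auto simp: D_def)
  qed
  ultimately have "card (two_line_paths (grid A) (grid_lines A) b b') \<le> card (SIGMA m:{..<A}. D m)"
    by (meson card_image_le card_mono finite_SigmaI finite_imageI finite_lessThan le_trans)
  also have "\<dots> = (\<Sum>m<A. card (D m))" using finD by simp
  also have "\<dots> \<le> (\<Sum>m<A. 2 * T)" using cardD by (rule sum_mono)
  finally show ?thesis by simp
qed

section \<open>Padding with isolated points and lines\<close>

text \<open>
  Finitely many lines cover only a set of measure zero.
\<close>

lemma infinite_off_lines:
  assumes "finite L" "\<And>l. l \<in> L \<Longrightarrow> is_line l"
  shows "infinite (- \<Union> L)"
proof
  assume "finite (- \<Union> L)"
  then have "negligible (- \<Union> L)" by (rule negligible_finite)
  moreover have "negligible (\<Union> L)"
  proof (rule negligible_Union[OF assms(1)])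
    fix l assume "l \<in> L"
    then have "aff_dim l < DIM(real ^ 2)" using assms(2) by (auto simp: is_line_def)
    then obtain a c where "a \<noteq> 0" "l \<subseteq> {x. a \<bullet> x = c}"
      by (rule aff_lowdim_subset_hyperplane)
    then show "negligible l"
      using negligible_hyperplane negligible_subset by blast
  qed
  ultimately have "negligible (- \<Union> L \<union> \<Union> L)" by (rule negligible_Un)
  then have "negligible (UNIV :: point set)" by (simp only: Compl_partition2)
  then show False by simp
qed

definition vertical_line :: "real \<Rightarrow> point set" where
  "vertical_line c = {v. v $ 1 = c}"

lemma is_line_vertical_line: "is_line (vertical_line c)"
proof -
  have eq: "vertical_line c = {v. (axis 1 1 :: real ^ 2) \<bullet> v = c}"
    by (auto simp: vertical_line_def inner_axis')
  have "(axis 1 1 :: real ^ 2) \<noteq> 0" by (simp add: axis_eq_0_iff)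
  then show ?thesis unfolding is_line_def eq by (simp add: affine_hyperplane)
qed

lemma infinite_lines_avoiding:
  assumes "finite P"
  shows "infinite {l. is_line l \<and> l \<inter> P = {}}"
proof -
  have inj: "inj vertical_line"
  proof (rule injI)
    fix c d assume "vertical_line c = vertical_line d"
    moreover have "(vector [c, 0] :: point) \<in> vertical_line c" by (simp add: vertical_line_def)
    ultimately have "(vector [c, 0] :: point) \<in> vertical_line d" by simp
    then show "c = d" by (simp add: vertical_line_def)
  qed
  have "infinite (UNIV - (\<lambda>v. v $ 1) ` P)"
    using assms by (intro Diff_infinite_finite infinite_UNIV_char_0) auto
  then have "infinite (vertical_line ` (UNIV - (\<lambda>v. v $ 1) ` P))"
    using inj by (meson finite_imageD inj_on_subset subset_UNIV)
  moreover have "vertical_line ` (UNIV - (\<lambda>v. v $ 1) ` P) \<subseteq> {l. is_line l \<and> l \<inter> P = {}}"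
    using is_line_vertical_line by (auto simp: vertical_line_def)
  ultimately show ?thesis using finite_subset by blast
qed

text \<open>
  The added points avoid all lines of \<open>L\<close> and the added lines avoid all points, so no new incidence
  arises. As a copy of a subdivided clique has no isolated point or line, it cannot use the added
  ones.
\<close>

theorem pad_with_isolated:
  assumes conf: "configuration P L" "card P \<le> n" "card L \<le> n"
    and free: "\<And>P1 L1. P1 \<subseteq> P \<Longrightarrow> L1 \<subseteq> L \<Longrightarrow> \<not> clique_copy k P1 L1" and k: "k \<ge> 2"
  obtains P' L' where "configuration P' L'" "card P' = n" "card L' = n"
    "incidences P' L' = incidences P L" "\<not> contains_subdivided_clique k P' L'"
proof -
  have fin: "finite P" "finite L" and lines: "\<And>l. l \<in> L \<Longrightarrow> is_line l"
    using conf by (auto simp: configuration_def)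
  have "infinite (- \<Union> L - P)"
    using infinite_off_lines[OF fin(2) lines] fin(1) by (rule Diff_infinite_finite[rotated])
  then obtain Q where Q: "finite Q" "card Q = n - card P" "Q \<subseteq> - \<Union> L - P"
    using infinite_arbitrarily_large by blast
  have "infinite ({l. is_line l \<and> l \<inter> (P \<union> Q) = {}} - L)"
    using infinite_lines_avoiding[of "P \<union> Q"] fin Q by (intro Diff_infinite_finite) auto
  then obtain M where M: "finite M" "card M = n - card L" "M \<subseteq> {l. is_line l \<and> l \<inter> (P \<union> Q) = {}} - L"
    using infinite_arbitrarily_large by blast
  show thesis
  proof
    show "configuration (P \<union> Q) (L \<union> M)"
      using fin Q M lines by (auto simp: configuration_def)
    show "card (P \<union> Q) = n" using fin Q conf by (subst card_Un_disjoint) auto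
    show "card (L \<union> M) = n" using fin M conf by (subst card_Un_disjoint) auto
    show inc: "incidences (P \<union> Q) (L \<union> M) = incidences P L"
      using Q M by (auto simp: incidences_def)
    show "\<not> contains_subdivided_clique k (P \<union> Q) (L \<union> M)"
    proof
      assume "contains_subdivided_clique k (P \<union> Q) (L \<union> M)"
      then obtain P1 L1 where copy: "P1 \<subseteq> P \<union> Q" "L1 \<subseteq> L \<union> M" "clique_copy k P1 L1"
        by (rule clique_copy_if_contains)
      note non_isolated = clique_copy_not_isolated[OF copy(3) k]
      have on: "p \<in> P \<and> l \<in> L" if "p \<in> P1" "l \<in> L1" "p \<in> l" for p l
      proof -
        have "(p, l) \<in> incidences (P \<union> Q) (L \<union> M)" using that copy by (auto simp: incidences_def)
        then show ?thesis unfolding inc by (simp add: incidences_def)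
      qed
      have "P1 \<subseteq> P" "L1 \<subseteq> L" using on non_isolated by blast+
      then show False using free copy(3) by blast
    qed
  qed
qed

section \<open>The choice of the grid and the asymptotics\<close>

text \<open>
  The grid, the count of copies and the deletion argument combined, with explicit conditions on the
  parameters. Here \<open>q = n / N\<close> with \<open>N = 2 * A ^ 3\<close>, the number of copies is at most
  \<open>N ^ k * (A * (2 * T)) ^ C\<close>, and a copy has \<open>k + 3 * C\<close> points and lines. The condition
  \<open>4 * C * A\<^sup>2 \<le> n\<close> means \<open>2 * C \<le> A * q\<close>, so that the lines of a copy itself contribute no more to
  the cost of a deletion than the bound \<open>A * q\<close> for the other lines. The last condition then makes the
  expected loss at most half of \<open>A ^ 4 * q\<^sup>2\<close>.
\<close>

theorem clique_free_configuration:
  fixes A n T k :: nat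
  defines "C \<equiv> k choose 2"
  assumes k: "k \<ge> 3" and A: "A \<ge> 1" and n: "n \<le> 2 * A ^ 3"
    and T: "\<And>j. 0 < j \<Longrightarrow> j \<le> A\<^sup>2 \<Longrightarrow> divisor_count j \<le> T"
    and rich: "4 * C * A\<^sup>2 \<le> n"
    and sparse: "T ^ C * n ^ (k - 1 + 3 * C) \<le> A ^ (8 * C)"
  obtains P L where "configuration P L" "card P = n" "card L = n"
    "(real n)\<^sup>2 / (8 * (real A)\<^sup>2) \<le> real (card (incidences P L))"
    "\<not> contains_subdivided_clique k P L"
proof -
  define F where "F = {(S, M). S \<subseteq> grid A \<and> M \<subseteq> grid_lines A \<and> clique_copy k S M}"
  define N where "N = 2 * A ^ 3"
  define q where "q = real n / real N"
  define s where "s = k - 1 + 3 * C"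
  have N0: "N > 0" using A by (simp add: N_def)
  have q0: "q \<ge> 0" by (simp add: q_def)
  have "k choose 2 \<ge> 3 choose 2" using k by (rule binomial_right_mono)
  then have C3: "C \<ge> 3" by (simp add: C_def numeral_eq_Suc)
  have finF: "finite F"
    by (rule finite_subset[of _ "Pow (grid A) \<times> Pow (grid_lines A)"]) (auto simp: F_def)
  have paths: "card (two_line_paths (grid A) (grid_lines A) b b') \<le> A * (2 * T)"
    if "b \<in> grid A" "b' \<in> grid A" for b b'
    using card_grid_two_line_paths_le[OF T that] .
  have "card F \<le> card (grid A) ^ k * (A * (2 * T)) ^ C"
    unfolding F_def C_def by (rule card_clique_copies_le[OF finite_grid k]) (rule paths)
  then have cardF: "card F \<le> N ^ k * (A * (2 * T)) ^ C"
    by (simp only: card_grid N_def)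
  \<comment> \<open>All powers of 2 are absorbed because \<open>2 + k + C \<le> k - 1 + 3 * C\<close> for \<open>C \<ge> 3\<close>.\<close>
  have few: "4 * card F * n ^ s \<le> A ^ 3 * N ^ s"
  proof -
    have "4 * card F * n ^ s \<le> 4 * (N ^ k * (A * (2 * T)) ^ C) * n ^ s"
      using cardF by simp
    also have "\<dots> = 2 ^ (2 + k + C) * A ^ (3 * k + C) * (T ^ C * n ^ s)"
      by (simp add: N_def power_mult_distrib power_add mult_ac flip: power_mult)
    also have "\<dots> \<le> 2 ^ s * A ^ (3 * k + C) * A ^ (8 * C)"
      using sparse C3 k A unfolding s_def by (intro mult_mono power_increasing) auto
    also have "\<dots> = A ^ 3 * N ^ s"
    proof -
      have "A ^ (3 * k + C) * A ^ (8 * C) = A ^ (3 + 3 * s)"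
        unfolding power_add[symmetric] s_def using k by (intro arg_cong[of _ _ "power A"]) auto
      moreover have "N ^ s = 2 ^ s * A ^ (3 * s)"
        by (simp add: N_def power_mult_distrib flip: power_mult)
      ultimately show ?thesis by (simp add: mult.assoc power_add)
    qed
    finally show ?thesis .
  qed
  have few_q: "4 * real (card F) * q ^ s \<le> real A ^ 3"
  proof -
    have "real (4 * card F * n ^ s) \<le> real (A ^ 3 * N ^ s)"
      using few by (simp only: of_nat_le_iff)
    then show ?thesis using N0 by (simp add: q_def field_simps)
  qed
  have Aq: "real (2 * C) \<le> real A * q"
  proof -
    have "real (4 * C * A\<^sup>2) \<le> real n" using rich by (simp only: of_nat_le_iff)
    then show ?thesis using A by (simp add: q_def N_def field_simps power2_eq_square power3_eq_cube)
  qed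
  have card_copy: "S \<subseteq> grid A \<and> M \<subseteq> grid_lines A \<and> S \<noteq> {} \<and> card S = k + C \<and> card M = 2 * C"
    if "(S, M) \<in> F" for S M
    using that clique_copy_card[of k S M] k unfolding F_def C_def by auto
  have "\<exists>P L. P \<subseteq> grid A \<and> L \<subseteq> grid_lines A \<and> card P \<le> n \<and> card L \<le> n \<and>
      (\<forall>(S, M) \<in> F. \<not> (S \<subseteq> P \<and> M \<subseteq> L)) \<and>
      real (card {(v, l). v \<in> grid A \<and> l \<in> grid_lines A \<and> v \<in> l}) * q\<^sup>2
        - real (card F) * (real (2 * C) * q ^ (k + C + 2 * C) + real A * q ^ (k + C + 2 * C + 1))
      \<le> real (card {(v, l). v \<in> P \<and> l \<in> L \<and> v \<in> l})"
    unfolding q_def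
    by (rule deletion_method[where R = "\<lambda>v l. v \<in> l", OF finite_grid finF card_grid[of A, folded N_def]
        n[folded N_def] N0 card_copy card_grid_lines_through_le])
  then obtain P L where PL: "P \<subseteq> grid A" "L \<subseteq> grid_lines A" "card P \<le> n" "card L \<le> n"
    and free: "\<forall>(S, M) \<in> F. \<not> (S \<subseteq> P \<and> M \<subseteq> L)"
    and inc: "real (card {(v, l). v \<in> grid A \<and> l \<in> grid_lines A \<and> v \<in> l}) * q\<^sup>2
        - real (card F) * (real (2 * C) * q ^ (k + C + 2 * C) + real A * q ^ (k + C + 2 * C + 1))
      \<le> real (card {(v, l). v \<in> P \<and> l \<in> L \<and> v \<in> l})"
    by (elim exE conjE) (rule that)
  have ks: "k + C + 2 * C = s + 1" using k by (simp add: s_def)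
  have "real (card F) * (real (2 * C) * q ^ (k + C + 2 * C) + real A * q ^ (k + C + 2 * C + 1))
      \<le> real (card F) * (real A * q * q ^ (s + 1) + real A * q ^ (s + 1 + 1))"
    unfolding ks using Aq q0 by (intro mult_left_mono add_right_mono mult_right_mono) auto
  also have "\<dots> = (4 * real (card F) * q ^ s) * (real A * q\<^sup>2 / 2)"
    by (simp add: power2_eq_square algebra_simps)
  also have "\<dots> \<le> real A ^ 3 * (real A * q\<^sup>2 / 2)"
    using few_q by (intro mult_right_mono) auto
  also have "\<dots> = real A ^ 4 * q\<^sup>2 / 2" by (simp add: power_numeral_reduce)
  finally have loss: "real (card F) * (real (2 * C) * q ^ (k + C + 2 * C) + real A * q ^ (k + C + 2 * C + 1))
      \<le> real A ^ 4 * q\<^sup>2 / 2" .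
  have "real (A ^ 4) \<le> real (card {(v, l). v \<in> grid A \<and> l \<in> grid_lines A \<and> v \<in> l})"
    using card_grid_incidences_ge by (simp only: of_nat_le_iff)
  then have "real A ^ 4 * q\<^sup>2 \<le> real (card {(v, l). v \<in> grid A \<and> l \<in> grid_lines A \<and> v \<in> l}) * q\<^sup>2"
    by (intro mult_right_mono) auto
  then have inc': "real A ^ 4 * q\<^sup>2 / 2 \<le> real (card (incidences P L))"
    using inc loss unfolding incidences_def by linarith
  have "real A ^ 4 * q\<^sup>2 / 2 = (real n)\<^sup>2 / (8 * (real A)\<^sup>2)"
    using A by (simp add: q_def N_def field_simps power_numeral_reduce)
  note inc'' = inc'[unfolded this]
  have conf: "configuration P L"
    unfolding configuration_def
  proof (intro conjI ballI)
    show "finite P" "finite L" using PL finite_grid finite_subset by blast+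
    show "is_line l" if "l \<in> L" for l
      using that PL is_line_slope_line by (auto simp: grid_lines_def)
  qed
  have nocopy: "\<not> clique_copy k P1 L1" if "P1 \<subseteq> P" "L1 \<subseteq> L" for P1 L1
  proof
    assume "clique_copy k P1 L1"
    then have "(P1, L1) \<in> F" using that PL by (auto simp: F_def)
    then show False using free that by blast
  qed
  have "k \<ge> 2" using k by simp
  from pad_with_isolated[OF conf PL(3,4) nocopy this]
  obtain P' L' where "configuration P' L'" "card P' = n" "card L' = n"
    "incidences P' L' = incidences P L" "\<not> contains_subdivided_clique k P' L'"
    by blast
  then show thesis using that inc'' by metis
qed

lemma real_choose_two: "real (k choose 2) = real k * (real k - 1) / 2"
proof (induction k)
  case (Suc k)
  have "Suc k choose 2 = k + (k choose 2)" by (simp add: numeral_2_eq_2)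
  then show ?case using Suc by (simp add: field_simps)
qed simp

lemma eventually_ge_powr:
  assumes "c > 0"
  shows "\<forall>\<^sub>F n in sequentially. K \<le> real n powr c"
proof -
  have "filterlim (\<lambda>n. real n powr c) at_top sequentially"
    using filterlim_compose[OF real_powr_at_top[OF assms] filterlim_real_sequentially] .
  then show ?thesis by (simp add: filterlim_at_top)
qed

text \<open>
  The condition \<open>T ^ C * n ^ (k - 1 + 3 * C) \<le> A ^ (8 * C)\<close> would hold with \<open>T = 1\<close> for
  \<open>A = n powr \<gamma>\<close>, where \<open>\<gamma> = (3 k + 2) / (8 k)\<close>, because \<open>k - 1 + 3 * C = 8 * C * \<gamma>\<close>. Enlarging the
  exponent by \<open>\<delta>\<close> gains a factor \<open>n powr (8 * \<delta> * C)\<close>, which beats the power \<open>T ^ C\<close> if the divisor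
  bound is used with exponent \<open>\<delta>\<close>: then \<open>T\<close> is at most a constant times \<open>n powr (2 * \<delta>)\<close>. The enlargement
  lowers the exponent of the number of incidences by \<open>2 * \<delta>\<close>, and a further \<open>\<delta>\<close> pays for constant
  factors.
\<close>

theorem eventually_clique_free_configuration:
  fixes k :: nat and \<delta> :: real
  assumes k: "k \<ge> 3" and \<delta>: "0 < \<delta>" "\<delta> \<le> 1 / 48"
  shows "\<forall>\<^sub>F n in sequentially. \<exists>P L. configuration P L \<and> card P = n \<and> card L = n \<and>
     real n powr (5 / 4 - 1 / (2 * real k) - 3 * \<delta>) \<le> real (card (incidences P L)) \<and>
     \<not> contains_subdivided_clique k P L"
proof -
  obtain K where K: "K > 0" "\<And>n. n > 0 \<Longrightarrow> real (divisor_count n) \<le> K * real n powr \<delta>"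
    using divisor_bound[OF \<delta>(1)] by blast
  define \<gamma> where "\<gamma> = (3 * real k + 2) / (8 * real k)"
  define C where "C = k choose 2"
  have \<gamma>: "2 * \<gamma> = 3 / 4 + 1 / (2 * real k)" using k by (simp add: \<gamma>_def field_simps)
  have "1 / (2 * real k) \<le> 1 / 6" using k by (simp add: field_simps)
  then have \<gamma>_le: "2 * \<gamma> \<le> 11 / 12" using \<gamma> by simp
  have "1 / (2 * real k) \<ge> 0" by simp
  then have \<gamma>_ge: "3 * \<gamma> \<ge> 1" using \<gamma> by linarith
  have exponent: "real (k - 1 + 3 * C) = 8 * real C * \<gamma>"
    using k by (simp add: C_def real_choose_two \<gamma>_def of_nat_diff field_simps)
  have "1 - 2 * \<gamma> - 2 * \<delta> > 0" using \<gamma>_le \<delta> by simp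
  then have ev_rich: "\<forall>\<^sub>F n in sequentially. 16 * real C \<le> real n powr (1 - 2 * \<gamma> - 2 * \<delta>)"
    by (rule eventually_ge_powr)
  have ev_div: "\<forall>\<^sub>F n in sequentially. K * 2 powr (2 * \<delta>) \<le> real n powr (6 * \<delta>)"
    using \<delta> by (intro eventually_ge_powr) simp
  have ev_const: "\<forall>\<^sub>F n in sequentially. 32 \<le> real n powr \<delta>"
    using \<delta> by (intro eventually_ge_powr) simp
  show ?thesis
    using eventually_gt_at_top[of 0] ev_rich ev_div ev_const
  proof eventually_elim
    case (elim n)
    define y where "y = real n powr (\<gamma> + \<delta>)"
    define A where "A = nat \<lceil>y\<rceil>"
    define T where "T = nat \<lfloor>K * (real A)\<^sup>2 powr \<delta>\<rfloor>"
    have n1: "real n \<ge> 1" using elim(1) by simp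
    have y1: "y \<ge> 1" unfolding y_def using n1 \<gamma>_ge \<delta> by (intro ge_one_powr_ge_zero) auto
    have yA: "y \<le> real A" unfolding A_def by linarith
    have "real A \<le> y + 1" unfolding A_def using y1 by linarith
    then have A2y: "real A \<le> 2 * y" using y1 by linarith
    have A1: "A \<ge> 1" using yA y1 by linarith
    have "y \<le> real n powr 1"
      unfolding y_def using n1 \<gamma>_le \<delta> by (intro powr_mono) auto
    then have A2n: "real A \<le> 2 * real n" using A2y n1 by simp
    have y_power: "y ^ m = real n powr (real m * (\<gamma> + \<delta>))" for m
      unfolding y_def using n1 by (simp add: powr_powr mult.commute flip: powr_realpow)
    have T_le: "real T \<le> K * (real A)\<^sup>2 powr \<delta>"
      unfolding T_def using K(1) by simp
    have T: "divisor_count j \<le> T" if j: "0 < j" "j \<le> A\<^sup>2" for j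
    proof -
      have "real j \<le> (real A)\<^sup>2" using j(2) by (metis of_nat_le_iff of_nat_power)
      then have "real j powr \<delta> \<le> (real A)\<^sup>2 powr \<delta>" using \<delta> by (intro powr_mono2) auto
      then have "real (divisor_count j) \<le> K * (real A)\<^sup>2 powr \<delta>"
        using K(2)[OF j(1)] K(1) by (meson less_imp_le mult_left_mono order_trans)
      then show ?thesis unfolding T_def by (simp add: le_nat_floor)
    qed
    have T_le_n: "real T \<le> real n powr (8 * \<delta>)"
    proof -
      have "(real A)\<^sup>2 powr \<delta> = real A powr (2 * \<delta>)"
        using A1 by (simp add: powr_powr flip: powr_numeral)
      also have "\<dots> \<le> (2 * real n) powr (2 * \<delta>)"
        using A2n \<delta> by (intro powr_mono2) auto
      also have "\<dots> = 2 powr (2 * \<delta>) * real n powr (2 * \<delta>)" by (simp add: powr_mult)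
      finally have "K * (real A)\<^sup>2 powr \<delta> \<le> K * (2 powr (2 * \<delta>) * real n powr (2 * \<delta>))"
        using K(1) by (intro mult_left_mono) auto
      then have "real T \<le> (K * 2 powr (2 * \<delta>)) * real n powr (2 * \<delta>)"
        using T_le by (simp add: mult.assoc)
      also have "\<dots> \<le> real n powr (6 * \<delta>) * real n powr (2 * \<delta>)"
        using elim(3) by (intro mult_right_mono) auto
      also have "\<dots> = real n powr (8 * \<delta>)" by (simp flip: powr_add)
      finally show ?thesis .
    qed
    have sparse: "T ^ C * n ^ (k - 1 + 3 * C) \<le> A ^ (8 * C)"
    proof -
      have "real T ^ C * real n ^ (k - 1 + 3 * C)
          \<le> (real n powr (8 * \<delta>)) ^ C * real n powr (8 * real C * \<gamma>)"
        using T_le_n n1 exponent by (intro mult_mono power_mono) (auto simp flip: powr_realpow)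
      also have "\<dots> = y ^ (8 * C)"
        using n1 by (simp add: y_power powr_powr algebra_simps flip: powr_realpow powr_add)
      also have "\<dots> \<le> real A ^ (8 * C)" using yA y1 by (intro power_mono) auto
      finally show ?thesis by (simp flip: of_nat_power of_nat_mult)
    qed
    have rich: "4 * C * A\<^sup>2 \<le> n"
    proof -
      have "(real A)\<^sup>2 \<le> (2 * y)\<^sup>2" using A2y by (intro power_mono) auto
      then have "4 * real C * (real A)\<^sup>2 \<le> 4 * real C * (2 * y)\<^sup>2"
        by (intro mult_left_mono) auto
      also have "\<dots> = 16 * real C * y\<^sup>2" by (simp add: power_mult_distrib)
      also have "\<dots> \<le> real n powr (1 - 2 * \<gamma> - 2 * \<delta>) * y\<^sup>2"
        using elim(2) by (intro mult_right_mono) auto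
      also have "\<dots> = real n"
        unfolding y_power using n1 by (simp add: algebra_simps flip: powr_add)
      finally have "real (4 * C * A\<^sup>2) \<le> real n" by simp
      then show ?thesis by (simp only: of_nat_le_iff)
    qed
    have n_le: "n \<le> 2 * A ^ 3"
    proof -
      have "real n = real n powr 1" using n1 by simp
      also have "\<dots> \<le> y ^ 3" unfolding y_power using n1 \<gamma>_ge \<delta> by (intro powr_mono) auto
      also have "\<dots> \<le> real A ^ 3" using yA y1 by (intro power_mono) auto
      finally have "n \<le> A ^ 3" by (simp flip: of_nat_power)
      then show ?thesis by simp
    qed
    obtain P L where PL: "configuration P L" "card P = n" "card L = n"
      "(real n)\<^sup>2 / (8 * (real A)\<^sup>2) \<le> real (card (incidences P L))"
      "\<not> contains_subdivided_clique k P L"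
      using clique_free_configuration[OF k A1 n_le T rich[unfolded C_def] sparse[unfolded C_def]] by metis
    have "real n powr (5 / 4 - 1 / (2 * real k) - 3 * \<delta>) * (8 * (real A)\<^sup>2)
        \<le> real n powr (2 - 2 * \<gamma> - 3 * \<delta>) * (8 * (2 * y)\<^sup>2)"
      using A2y \<gamma> by (intro mult_mono power_mono) auto
    also have "\<dots> = 32 * real n powr (2 - \<delta>)"
      unfolding power_mult_distrib y_power using n1 by (simp add: algebra_simps flip: powr_add)
    also have "\<dots> \<le> real n powr \<delta> * real n powr (2 - \<delta>)"
      using elim(4) by (intro mult_right_mono) auto
    also have "\<dots> = (real n)\<^sup>2" using n1 by (simp flip: powr_add)
    finally have "real n powr (5 / 4 - 1 / (2 * real k) - 3 * \<delta>) \<le> (real n)\<^sup>2 / (8 * (real A)\<^sup>2)"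
      using A1 by (simp add: field_simps)
    from order_trans[OF this PL(4)] show ?case using PL(1-3,5) by blast
  qed
qed

text \<open>
  A single incidence suffices where the asymptotic construction is not available: it makes
  the largest number of incidences positive for every \<open>n\<close>, so that its logarithm is meaningful.
\<close>

lemma single_incidence_configuration:
  assumes "k \<ge> 3" "n \<ge> 1"
  obtains P L where "configuration P L" "card P = n" "card L = n"
    "card (incidences P L) = 1" "\<not> contains_subdivided_clique k P L"
proof -
  have conf: "configuration {0} {vertical_line 0}"
    using is_line_vertical_line by (simp add: configuration_def)
  have nocopy: "\<not> clique_copy k P1 L1" if "P1 \<subseteq> {0}" "L1 \<subseteq> {vertical_line 0}" for P1 L1
  proof
    assume "clique_copy k P1 L1"
    then have "card P1 \<ge> 3" using clique_copy_card(1)[of k P1 L1] assms(1) by simp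
    moreover have "card P1 \<le> 1" using card_mono[OF _ that(1)] by simp
    ultimately show False by simp
  qed
  have "incidences {0} {vertical_line 0} = {(0, vertical_line 0)}"
    by (auto simp: incidences_def vertical_line_def)
  then have one: "card (incidences {0} {vertical_line 0}) = 1" by simp
  have "card {0 :: point} \<le> n" "card {vertical_line 0} \<le> n" "k \<ge> 2" using assms by simp_all
  from pad_with_isolated[OF conf this(1,2) nocopy this(3)] show thesis
    using that one by metis
qed

text \<open>
  The error exponent is read off from the largest number \<open>M n\<close> of incidences of a clique-free
  configuration of size \<open>n\<close>. Truncating it at zero spares an upper bound for \<open>M n\<close>: only \<open>\<epsilon> n\<close>
  not being too negative has to be shown. For \<open>n = 1\<close> the quotient of
  logarithms has no meaning, but every power of 1 is 1.
\<close>

theorem theorem6: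
  fixes k :: nat
  assumes "k \<ge> 3"
  shows "\<exists>\<epsilon> :: nat \<Rightarrow> real. \<epsilon> \<longlonglongrightarrow> 0 \<and>
    (\<forall>n\<ge>1. \<exists>P L. configuration P L \<and> card P = n \<and> card L = n \<and>
       real (card (incidences P L)) \<ge> real n powr (5 / 4 - 1 / (2 * real k) + \<epsilon> n) \<and>
       \<not> contains_subdivided_clique k P L)"
proof -
  define e where "e = 5 / 4 - 1 / (2 * real k)"
  define S where "S n = {card (incidences P L) | P L. configuration P L \<and> card P = n \<and>
    card L = n \<and> \<not> contains_subdivided_clique k P L}" for n
  define M where "M n = Max (S n)" for n
  define \<epsilon> where "\<epsilon> n = min 0 (ln (real (M n)) / ln (real n) - e)" for n
  have finS: "finite (S n)" for n
  proof (rule finite_subset[of _ "{..n * n}"])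
    show "S n \<subseteq> {..n * n}"
    proof (rule subsetI)
      fix c assume "c \<in> S n"
      then obtain P L where PL: "c = card (incidences P L)" "configuration P L" "card P = n" "card L = n"
        by (auto simp: S_def)
      have "card (incidences P L) \<le> card (P \<times> L)"
        using PL(2) by (intro card_mono) (auto simp: configuration_def incidences_def)
      then show "c \<in> {..n * n}" using PL by (simp add: card_cartesian_product)
    qed
  qed simp
  have M1: "M n \<ge> 1" "M n \<in> S n" if n: "n \<ge> 1" for n
  proof -
    have one: "1 \<in> S n"
    proof (rule single_incidence_configuration[OF assms n])
      fix P L assume "configuration P L" "card P = n" "card L = n"
        "card (incidences P L) = 1" "\<not> contains_subdivided_clique k P L"
      then show "1 \<in> S n" unfolding S_def by (intro CollectI exI[of _ P] exI[of _ L]) simp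
    qed
    then show "M n \<in> S n" unfolding M_def using finS by (intro Max_in) auto
    show "M n \<ge> 1" unfolding M_def using finS one by (rule Max_ge)
  qed
  have "\<epsilon> \<longlonglongrightarrow> 0"
  proof (rule tendstoI)
    fix r :: real assume r: "r > 0"
    define \<delta> where "\<delta> = min (1 / 48) (r / 6)"
    have \<delta>: "0 < \<delta>" "\<delta> \<le> 1 / 48" "3 * \<delta> < r" using r by (auto simp: \<delta>_def)
    show "\<forall>\<^sub>F n in sequentially. dist (\<epsilon> n) 0 < r"
      using eventually_gt_at_top[of 1] eventually_clique_free_configuration[OF assms \<delta>(1,2)]
    proof eventually_elim
      case (elim n)
      then obtain P L where PL: "configuration P L" "card P = n" "card L = n"
         "real n powr (e - 3 * \<delta>) \<le> real (card (incidences P L))"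
         "\<not> contains_subdivided_clique k P L" unfolding e_def by blast
      then have "card (incidences P L) \<in> S n" by (auto simp: S_def)
      then have "card (incidences P L) \<le> M n" unfolding M_def using finS by (intro Max_ge)
      then have "real n powr (e - 3 * \<delta>) \<le> real (M n)" using PL(4) by simp
      then have "ln (real n powr (e - 3 * \<delta>)) \<le> ln (real (M n))"
        using elim(1) M1(1)[of n] by (subst ln_le_cancel_iff) auto
      then have "e - 3 * \<delta> \<le> ln (real (M n)) / ln (real n)"
        using elim(1) by (simp add: ln_powr field_simps)
      then show "dist (\<epsilon> n) 0 < r" using \<delta>(3) r by (auto simp: \<epsilon>_def dist_real_def)
    qed
  qed
  moreover have "\<exists>P L. configuration P L \<and> card P = n \<and> card L = n \<and>
       real (card (incidences P L)) \<ge> real n powr (e + \<epsilon> n) \<and>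
       \<not> contains_subdivided_clique k P L" if n: "n \<ge> 1" for n
  proof -
    have "real n powr (e + \<epsilon> n) \<le> real (M n)"
    proof (cases "n = 1")
      case True
      then show ?thesis using M1(1)[OF n] by simp
    next
      case False
      then have n2: "real n > 1" using n by simp
      have "real n powr (e + \<epsilon> n) \<le> real n powr (ln (real (M n)) / ln (real n))"
        using n2 by (intro powr_mono) (auto simp: \<epsilon>_def)
      also have "\<dots> = real (M n)" using n2 M1(1)[OF n] by (simp add: powr_def)
      finally show ?thesis .
    qed
    moreover obtain P L where "M n = card (incidences P L)" "configuration P L" "card P = n"
      "card L = n" "\<not> contains_subdivided_clique k P L"
      using M1(2)[OF n] unfolding S_def by blast
    ultimately show ?thesis by metis
  qed
  ultimately show ?thesis unfolding e_def by blast
qed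

end
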